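(* Consider the normal, misère and escape games on the Galton-Watson tree with offspring distribution $\mathbf p$, and regard all outcome probabilities as functions of $\mathbf p$. (i) The probabilities $N,P,\widetilde N,\widetilde P,S^{(1)},S^{(2)}$ are lower semicontinuous as functions of $\mathbf p\in M_0$ with respect to $d_0$. Hence $D$ is upper semicontinuous, and $N$ and $P$ are continuous on $\{\mathbf p: D=0\}$; and similarly for the misère game ($\widetilde D$ is upper semicontinuous, and $\widetilde N$ and $\widetilde P$ are continuous on $\{\mathbf p:\widetilde D=0\}$). (ii) The probabilities $D$ and $\widetilde D$ are continuous with respect to $d_0$ on the set of distributions $\mathbf p$ supported on $\{0,1,2\}$ and satisfying $0<p_0<1$. (iii) The set $\{\mathbf p: E^{(1)}>0\}$ contains $\{\mathbf p\in M_1:\mu p_1>1\}$, and is closed with respect to $d_1$ in $\{\mathbf p\in M_1:\mu p_1<1\}$ (that is, its intersection with the latter set is relatively closed in it). We have $E^{(1)}>0$ if and only if $E^{(2)}>0$.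
   Context: An offspring distribution is a probability mass function $\mathbf p=(p_0,p_1,\dots)$ on $\{0,1,2,\dots\}$; $\mu=\sum_i ip_i$ denotes its mean. $M_0$ is the space of all offspring distributions, with the $\ell^1$ metric $d_0(\mathbf p,\mathbf q)=\sum_i|p_i-q_i|$. $M_1$ is the space of offspring distributions with finite mean, with the metric $d_1(\mathbf p,\mathbf q)=\sum_i i|p_i-q_i|$. Let $\mathcal T$ be the Galton-Watson tree with offspring distribution $\mathbf p$, with edges directed from parents to children and root $o$. A token starts at $o$, and two players alternately move the token along a directed edge to a child of its current vertex. The tree is fully known to both players. A strategy for a player assigns to every vertex that has a child a legal move; it is winning if it yields a win for that player whatever strategy the opponent uses. Normal game: a player who cannot move loses and the other wins. Misère game: a player who cannot move wins and the other loses. In both, the game is a win for a player who has a winning strategy, and a draw if neither player has a winning strategy. Escape game: the players are Stopper and Escaper; Stopper wins if either player is ever unable to move; the game is a win for Escaper if Stopper has no winning strategy. $N$, $P$, $D=1-N-P$ are the probabilities (over $\mathcal T$) that the normal game is a win for the player moving first (Next), a win for the player moving second (Previous), a draw, respectively. $\widetilde N,\widetilde P,\widetilde D$ are the analogous probabilities for the misère game. $S^{(1)}$ (resp. $S^{(2)}$) is the probability that Stopper wins the escape game when Stopper moves first (resp. second). $E^{(1)}=1-S^{(2)}$ and $E^{(2)}=1-S^{(1)}$ are the win probabilities for Escaper when Escaper moves first or second respectively. *)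

theory Defs
  imports "HOL-Probability.Probability"
begin

subsection \<open>Spaces of offspring distributions\<close>

text \<open>An offspring distribution is a value of type \<^typ>\<open>nat pmf\<close>, so that the space
  \<open>M\<^sub>0\<close> of all offspring distributions is \<open>UNIV\<close>.\<close>

definition offspring_mean :: "nat pmf \<Rightarrow> real" where
  "offspring_mean p = measure_pmf.expectation p real"

definition M1 :: "nat pmf set" where
  "M1 = {p. integrable (measure_pmf p) real}"

text \<open>An unordered sum that does not converge is 0 by convention. This affects \<open>d1\<close> only
  outside \<open>M1\<close>.\<close>

definition d0 :: "nat pmf \<Rightarrow> nat pmf \<Rightarrow> real" where
  "d0 p q = (\<Sum>\<^sub>\<infinity>i. \<bar>pmf p i - pmf q i\<bar>)"

definition d1 :: "nat pmf \<Rightarrow> nat pmf \<Rightarrow> real" where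
  "d1 p q = (\<Sum>\<^sub>\<infinity>i. real i * \<bar>pmf p i - pmf q i\<bar>)"

lemma summable_on_iff_integrable_count_space:
  fixes f :: "'a \<Rightarrow> real"
  shows "f summable_on A \<longleftrightarrow> integrable (count_space A) f"
  by (rule trans[OF summable_on_iff_abs_summable_on_real
        trans[OF abs_summable_equivalent Infinite_Set_Sum.abs_summable_on_def]])

lemma summable_on_pmf: "pmf p summable_on A"
  unfolding summable_on_iff_integrable_count_space by (rule integrable_pmf)

lemma summable_on_M1: "p \<in> M1 \<longleftrightarrow> (\<lambda>i. real i * pmf p i) summable_on UNIV"
proof -
  have "p \<in> M1 \<longleftrightarrow> integrable (density (count_space UNIV) (\<lambda>x. ennreal (pmf p x))) real"
    unfolding M1_def measure_pmf_eq_density by simp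
  also have "\<dots> \<longleftrightarrow> integrable (count_space UNIV) (\<lambda>i. pmf p i *\<^sub>R real i)"
    by (rule integrable_density) auto
  also have "\<dots> \<longleftrightarrow> (\<lambda>i. real i * pmf p i) summable_on UNIV"
    by (simp add: summable_on_iff_integrable_count_space mult.commute)
  finally show ?thesis .
qed

lemma summable_on_diff_pmf: "(\<lambda>i. \<bar>pmf p i - pmf q i\<bar>) summable_on UNIV"
proof (rule summable_on_comparison_test)
  show "(\<lambda>i. pmf p i + pmf q i) summable_on UNIV"
    by (intro summable_on_add summable_on_pmf)
  show "\<bar>pmf p i - pmf q i\<bar> \<le> pmf p i + pmf q i" for i
    using pmf_nonneg[of p i] pmf_nonneg[of q i] by linarith
qed auto

lemma summable_on_diff_M1:
  assumes "p \<in> M1" "q \<in> M1"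
  shows "(\<lambda>i. real i * \<bar>pmf p i - pmf q i\<bar>) summable_on UNIV"
proof (rule summable_on_comparison_test)
  show "(\<lambda>i. real i * pmf p i + real i * pmf q i) summable_on UNIV"
    using assms by (intro summable_on_add) (auto simp: summable_on_M1)
  show "real i * \<bar>pmf p i - pmf q i\<bar> \<le> real i * pmf p i + real i * pmf q i" for i
  proof -
    have "\<bar>pmf p i - pmf q i\<bar> \<le> pmf p i + pmf q i"
      using pmf_nonneg[of p i] pmf_nonneg[of q i] by linarith
    then show ?thesis
      unfolding distrib_left[symmetric] by (rule mult_left_mono) simp
  qed
qed auto

lemma Metric_space_d0: "Metric_space UNIV d0"
proof
  fix p q r :: "nat pmf"
  show "0 \<le> d0 p q" "d0 p q = d0 q p"
    unfolding d0_def by (rule infsum_nonneg, simp) (simp only: abs_minus_commute)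
  show "d0 p q = 0 \<longleftrightarrow> p = q"
  proof
    assume "d0 p q = 0"
    then have "\<bar>pmf p i - pmf q i\<bar> = 0" for i
      unfolding d0_def by (intro nonneg_infsum_le_0D[OF _ summable_on_diff_pmf]) auto
    then show "p = q" by (intro pmf_eqI) simp
  qed (simp add: d0_def)
  have "d0 p r \<le> (\<Sum>\<^sub>\<infinity>i. \<bar>pmf p i - pmf q i\<bar> + \<bar>pmf q i - pmf r i\<bar>)"
    unfolding d0_def
  proof (rule infsum_mono)
    show "(\<lambda>i. \<bar>pmf p i - pmf q i\<bar> + \<bar>pmf q i - pmf r i\<bar>) summable_on UNIV"
      by (intro summable_on_add summable_on_diff_pmf)
  qed (auto simp: summable_on_diff_pmf)
  also have "\<dots> = d0 p q + d0 q r"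
    unfolding d0_def by (intro infsum_add summable_on_diff_pmf)
  finally show "d0 p r \<le> d0 p q + d0 q r" .
qed

lemma Metric_space_d1: "Metric_space M1 d1"
proof
  fix p q :: "nat pmf"
  show "0 \<le> d1 p q" "d1 p q = d1 q p"
    unfolding d1_def by (rule infsum_nonneg, simp) (simp only: abs_minus_commute)
next
  fix p q assume pq: "p \<in> M1" "q \<in> M1"
  show "d1 p q = 0 \<longleftrightarrow> p = q"
  proof
    assume "d1 p q = 0"
    then have "real i * \<bar>pmf p i - pmf q i\<bar> = 0" for i
      unfolding d1_def by (intro nonneg_infsum_le_0D[OF _ summable_on_diff_M1[OF pq]]) auto
    then have pos: "pmf p i = pmf q i" if "i \<noteq> 0" for i
      using that \<open>real i * \<bar>pmf p i - pmf q i\<bar> = 0\<close> by simp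
    have *: "pmf r 0 = 1 - infsum (pmf r) (UNIV - {0})" for r :: "nat pmf"
    proof -
      have "infsetsum (pmf r) UNIV = 1"
        by (rule infsetsum_pmf_eq_1) simp
      then have "infsum (pmf r) UNIV = 1"
        using infsetsum_infsum[OF pmf_abs_summable, of r UNIV] by linarith
      moreover have "infsum (pmf r) (insert 0 (UNIV - {0})) = pmf r 0 + infsum (pmf r) (UNIV - {0})"
        by (rule infsum_insert) (auto simp: summable_on_pmf)
      moreover have "insert 0 (UNIV - {0}) = (UNIV :: nat set)" by auto
      ultimately show ?thesis by simp
    qed
    have "infsum (pmf p) (UNIV - {0}) = infsum (pmf q) (UNIV - {0})"
      by (rule infsum_cong) (simp add: pos)
    then have "pmf p 0 = pmf q 0" using *[of p] *[of q] by linarith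
    show "p = q"
    proof (rule pmf_eqI)
      show "pmf p i = pmf q i" for i
        using pos[of i] \<open>pmf p 0 = pmf q 0\<close> by (cases "i = 0") auto
    qed
  qed (simp add: d1_def)
next
  fix p q r assume "p \<in> M1" "q \<in> M1" "r \<in> M1"
  note s = summable_on_diff_M1[OF this(1,2)] summable_on_diff_M1[OF this(2,3)]
    summable_on_diff_M1[OF this(1,3)]
  have "d1 p r \<le> (\<Sum>\<^sub>\<infinity>i. real i * \<bar>pmf p i - pmf q i\<bar> + real i * \<bar>pmf q i - pmf r i\<bar>)"
    unfolding d1_def
  proof (rule infsum_mono)
    show "(\<lambda>i. real i * \<bar>pmf p i - pmf q i\<bar> + real i * \<bar>pmf q i - pmf r i\<bar>) summable_on UNIV"
      by (intro summable_on_add s)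
    show "real i * \<bar>pmf p i - pmf r i\<bar>
        \<le> real i * \<bar>pmf p i - pmf q i\<bar> + real i * \<bar>pmf q i - pmf r i\<bar>" for i
      unfolding distrib_left[symmetric] by (rule mult_left_mono) auto
  qed (rule s)
  also have "\<dots> = d1 p q + d1 q r"
    unfolding d1_def by (intro infsum_add s)
  finally show "d1 p r \<le> d1 p q + d1 q r" .
qed

definition M0_topology :: "nat pmf topology" where
  "M0_topology = Metric_space.mtopology UNIV d0"

definition M1_topology :: "nat pmf topology" where
  "M1_topology = Metric_space.mtopology M1 d1"

definition lower_semicontinuous_map :: "'a topology \<Rightarrow> ('a \<Rightarrow> real) \<Rightarrow> bool" where
  "lower_semicontinuous_map X f \<longleftrightarrow> (\<forall>a. openin X {x \<in> topspace X. a < f x})"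

definition upper_semicontinuous_map :: "'a topology \<Rightarrow> ('a \<Rightarrow> real) \<Rightarrow> bool" where
  "upper_semicontinuous_map X f \<longleftrightarrow> (\<forall>a. openin X {x \<in> topspace X. f x < a})"


subsection \<open>Galton-Watson trees\<close>

text \<open>Potential vertices are lists of naturals; the root is \<open>[]\<close>, and the possible children of \<open>v\<close>
  are \<open>v @ [0], v @ [1], \<dots>\<close>. A tree is the set of its vertices. It is built from the family
  \<open>c\<close> of numbers of children, which are independent with law \<open>p\<close>.\<close>

inductive_set gw_tree :: "(nat list \<Rightarrow> nat) \<Rightarrow> nat list set" for c where
  root: "[] \<in> gw_tree c"
| child: "v \<in> gw_tree c \<Longrightarrow> i < c v \<Longrightarrow> v @ [i] \<in> gw_tree c"

definition gw_space :: "nat pmf \<Rightarrow> (nat list \<Rightarrow> nat) measure" where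
  "gw_space p = Pi\<^sub>M UNIV (\<lambda>_. measure_pmf p)"

definition gw_prob :: "nat pmf \<Rightarrow> (nat list set \<Rightarrow> bool) \<Rightarrow> real" where
  "gw_prob p Q = measure (gw_space p) {c \<in> space (gw_space p). Q (gw_tree c)}"


subsection \<open>Games on a tree\<close>

definition children :: "nat list set \<Rightarrow> nat list \<Rightarrow> nat list set" where
  "children T v = {w \<in> T. \<exists>i. w = v @ [i]}"

definition is_strategy :: "nat list set \<Rightarrow> (nat list \<Rightarrow> nat list) \<Rightarrow> bool" where
  "is_strategy T \<sigma> \<longleftrightarrow> (\<forall>v\<in>T. children T v \<noteq> {} \<longrightarrow> \<sigma> v \<in> children T v)"

text \<open>Here \<open>\<sigma>\<close> is the strategy of the player moving first and \<open>\<tau>\<close> that of the player moving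
  second. The positions are meaningful only until a player is unable to move.\<close>

fun play :: "(nat list \<Rightarrow> nat list) \<Rightarrow> (nat list \<Rightarrow> nat list) \<Rightarrow> nat \<Rightarrow> nat list" where
  "play \<sigma> \<tau> 0 = []"
| "play \<sigma> \<tau> (Suc n) = (if even n then \<sigma> else \<tau>) (play \<sigma> \<tau> n)"

text \<open>After exactly \<open>n\<close> moves the player to move is unable to do so. This player is the one who
  moved first if \<open>n\<close> is even, and the other one if \<open>n\<close> is odd.\<close>

definition ends_after ::
  "nat list set \<Rightarrow> (nat list \<Rightarrow> nat list) \<Rightarrow> (nat list \<Rightarrow> nat list) \<Rightarrow> nat \<Rightarrow> bool" where
  "ends_after T \<sigma> \<tau> n \<longleftrightarrow>
     children T (play \<sigma> \<tau> n) = {} \<and> (\<forall>m<n. children T (play \<sigma> \<tau> m) \<noteq> {})"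

definition first_stuck ::
  "nat list set \<Rightarrow> (nat list \<Rightarrow> nat list) \<Rightarrow> (nat list \<Rightarrow> nat list) \<Rightarrow> bool" where
  "first_stuck T \<sigma> \<tau> \<longleftrightarrow> (\<exists>n. even n \<and> ends_after T \<sigma> \<tau> n)"

definition second_stuck ::
  "nat list set \<Rightarrow> (nat list \<Rightarrow> nat list) \<Rightarrow> (nat list \<Rightarrow> nat list) \<Rightarrow> bool" where
  "second_stuck T \<sigma> \<tau> \<longleftrightarrow> (\<exists>n. odd n \<and> ends_after T \<sigma> \<tau> n)"

text \<open>\<open>W T \<sigma> \<tau>\<close> says that the play resulting from \<open>\<sigma>\<close> and \<open>\<tau>\<close> is won by the player
  in question.\<close>

definition first_has_winning_strategy ::
  "(nat list set \<Rightarrow> (nat list \<Rightarrow> nat list) \<Rightarrow> (nat list \<Rightarrow> nat list) \<Rightarrow> bool) \<Rightarrow>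
     nat list set \<Rightarrow> bool" where
  "first_has_winning_strategy W T \<longleftrightarrow>
     (\<exists>\<sigma>. is_strategy T \<sigma> \<and> (\<forall>\<tau>. is_strategy T \<tau> \<longrightarrow> W T \<sigma> \<tau>))"

definition second_has_winning_strategy ::
  "(nat list set \<Rightarrow> (nat list \<Rightarrow> nat list) \<Rightarrow> (nat list \<Rightarrow> nat list) \<Rightarrow> bool) \<Rightarrow>
     nat list set \<Rightarrow> bool" where
  "second_has_winning_strategy W T \<longleftrightarrow>
     (\<exists>\<tau>. is_strategy T \<tau> \<and> (\<forall>\<sigma>. is_strategy T \<sigma> \<longrightarrow> W T \<sigma> \<tau>))"


subsection \<open>Outcome probabilities\<close>

definition normal_N :: "nat pmf \<Rightarrow> real" where
  "normal_N p = gw_prob p (first_has_winning_strategy second_stuck)"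

definition normal_P :: "nat pmf \<Rightarrow> real" where
  "normal_P p = gw_prob p (second_has_winning_strategy first_stuck)"

definition normal_D :: "nat pmf \<Rightarrow> real" where
  "normal_D p = 1 - normal_N p - normal_P p"

definition misere_N :: "nat pmf \<Rightarrow> real" where
  "misere_N p = gw_prob p (first_has_winning_strategy first_stuck)"

definition misere_P :: "nat pmf \<Rightarrow> real" where
  "misere_P p = gw_prob p (second_has_winning_strategy second_stuck)"

definition misere_D :: "nat pmf \<Rightarrow> real" where
  "misere_D p = 1 - misere_N p - misere_P p"

definition either_stuck ::
  "nat list set \<Rightarrow> (nat list \<Rightarrow> nat list) \<Rightarrow> (nat list \<Rightarrow> nat list) \<Rightarrow> bool" where
  "either_stuck T \<sigma> \<tau> \<longleftrightarrow> first_stuck T \<sigma> \<tau> \<or> second_stuck T \<sigma> \<tau>"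

definition stopper_S1 :: "nat pmf \<Rightarrow> real" where
  "stopper_S1 p = gw_prob p (first_has_winning_strategy either_stuck)"

definition stopper_S2 :: "nat pmf \<Rightarrow> real" where
  "stopper_S2 p = gw_prob p (second_has_winning_strategy either_stuck)"

text \<open>The index of \<open>E\<close> refers to Escaper, so that Stopper moves second in \<open>escaper_E1\<close>.\<close>

definition escaper_E1 :: "nat pmf \<Rightarrow> real" where
  "escaper_E1 p = 1 - stopper_S2 p"

definition escaper_E2 :: "nat pmf \<Rightarrow> real" where
  "escaper_E2 p = 1 - stopper_S1 p"

end

theory Submission
  imports Defs
begin

text \<open>In each of the three games call one player the attacker, who has to force the game to end, in a
  good way. Since the tree is locally finite, the attacker wins iff he wins within a bounded number
  of moves. The probabilities of winning within \<open>n\<close> moves satisfy a recursion through the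
  generating function of \<open>p\<close>, hence are continuous in \<open>p\<close>; their suprema are lower semicontinuous
  and form the least solution of the limiting equations.

  For offspring distributions on \<open>{0, 1, 2}\<close> a draw has positive probability iff the resulting
  quadratic map has a genuine 2-cycle; the squared distance of its two points is a rational function
  of \<open>p\<close>, and the cycle lies strictly inside the unit interval, so it persists under perturbation.

  In the escape game \<open>e = E\<^sup>1\<close> is the largest solution of \<open>e = 1 - G (1 - (G e - p\<^sub>0))\<close>, whose right
  side has slope \<open>\<mu> p\<^sub>1\<close> at 0. If this exceeds 1, then \<open>e > 0\<close>. In general
  \<open>e \<le> \<mu> (p\<^sub>1 + e) e\<close>, so where \<open>\<mu> p\<^sub>1 < 1\<close> a positive \<open>e\<close> is locally bounded away from 0,
  and upper semicontinuity of \<open>e\<close> gives the claim on closedness.\<close>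

subsection \<open>Bounded winning in locally finite trees\<close>

text \<open>\<open>a\<close> and \<open>b\<close> tell whether the attacker wins if the attacker, respectively the defender, is
  unable to move: normal play is \<open>(False, True)\<close>, misere play \<open>(True, False)\<close>, and the escape game
  with Stopper attacking \<open>(True, True)\<close>. \<open>t\<close> says that it is the attacker's turn, and \<open>n\<close> is
  strictly greater than the number of moves allowed.\<close>

fun win :: "bool \<Rightarrow> bool \<Rightarrow> bool \<Rightarrow> nat \<Rightarrow> (nat list \<Rightarrow> nat) \<Rightarrow> bool" where
  "win a b t 0 c = False"
| "win a b t (Suc n) c =
     (if c [] = 0 then (if t then a else b)
      else if t then \<exists>i<c []. win a b False n (\<lambda>v. c (i # v))
      else \<forall>i<c []. win a b True n (\<lambda>v. c (i # v)))"

lemma win_0: "win a b t 0 = (\<lambda>c. False)"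
  by (simp add: fun_eq_iff)

lemma win_mono: "win a b t n c \<Longrightarrow> n \<le> m \<Longrightarrow> win a b t m c"
proof (induction n arbitrary: t c m)
  case (Suc n)
  then obtain m' where m': "m = Suc m'" "n \<le> m'"
    by (cases m) auto
  show ?case
    using Suc.prems(1) Suc.IH[OF _ m'(2)] by (auto simp: m'(1) split: if_splits)
qed simp

text \<open>\<open>win\<close> passes to a child by relabelling the tree, which suits the
  probabilistic recursion. Strategies refer to the vertices of one fixed tree, so here a subtree is
  addressed by its root instead.\<close>

definition win_at :: "bool \<Rightarrow> bool \<Rightarrow> bool \<Rightarrow> nat \<Rightarrow> (nat list \<Rightarrow> nat) \<Rightarrow> nat list \<Rightarrow> bool" where
  "win_at a b t n c v = win a b t n (\<lambda>w. c (v @ w))"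

lemma win_at_0 [simp]: "\<not> win_at a b t 0 c v"
  by (simp add: win_at_def)

lemma win_at_Suc:
  "win_at a b t (Suc n) c v =
     (if c v = 0 then (if t then a else b)
      else if t then \<exists>i<c v. win_at a b False n c (v @ [i])
      else \<forall>i<c v. win_at a b True n c (v @ [i]))"
  by (simp add: win_at_def)

lemma win_at_mono: "win_at a b t n c v \<Longrightarrow> n \<le> m \<Longrightarrow> win_at a b t m c v"
  unfolding win_at_def by (rule win_mono)

lemma win_at_root: "win_at a b t n c [] = win a b t n c"
  by (simp add: win_at_def)

section \<open>Strategies and plays on a Galton-Watson tree\<close>

lemma snoc_mem_gw_tree_iff: "v @ [i] \<in> gw_tree c \<longleftrightarrow> v \<in> gw_tree c \<and> i < c v"
  by (auto intro: gw_tree.child elim: gw_tree.cases)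

lemma children_gw_tree:
  "v \<in> gw_tree c \<Longrightarrow> children (gw_tree c) v = (\<lambda>i. v @ [i]) ` {..<c v}"
  by (auto simp: children_def snoc_mem_gw_tree_iff)

lemma children_gw_tree_empty_iff:
  "v \<in> gw_tree c \<Longrightarrow> children (gw_tree c) v = {} \<longleftrightarrow> c v = 0"
  by (auto simp: children_gw_tree)

lemma is_strategy_gw_treeD:
  assumes "is_strategy (gw_tree c) \<sigma>" "v \<in> gw_tree c" "0 < c v"
  obtains i where "i < c v" "\<sigma> v = v @ [i]"
  using assms by (fastforce simp: is_strategy_def children_gw_tree)

lemma is_strategy_gw_treeI:
  assumes "\<And>v. 0 < c v \<Longrightarrow> \<exists>i<c v. \<sigma> v = v @ [i]"
  shows "is_strategy (gw_tree c) \<sigma>"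
  unfolding is_strategy_def
proof (intro ballI impI)
  fix v assume v: "v \<in> gw_tree c" "children (gw_tree c) v \<noteq> {}"
  then obtain i where "i < c v" "\<sigma> v = v @ [i]"
    using assms[of v] by (auto simp: children_gw_tree)
  then show "\<sigma> v \<in> children (gw_tree c) v"
    using v(1) by (simp add: children_gw_tree)
qed

text \<open>Strategies are unconstrained at leaves, so a play is known to stay in the tree only
  while no earlier position was stuck.\<close>

lemma play_mem_tree:
  assumes "is_strategy (gw_tree c) \<sigma>" "is_strategy (gw_tree c) \<tau>"
    and "\<And>j. j < m \<Longrightarrow> children (gw_tree c) (play \<sigma> \<tau> j) \<noteq> {}"
  shows "play \<sigma> \<tau> m \<in> gw_tree c"
  using assms(3)
proof (induction m)
  case (Suc m)
  then have "play \<sigma> \<tau> m \<in> gw_tree c" "children (gw_tree c) (play \<sigma> \<tau> m) \<noteq> {}"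
    by auto
  then show ?case
    using assms(1,2) by (auto simp: is_strategy_def children_def)
qed (simp add: gw_tree.root)

text \<open>\<open>s\<close> says that the attacker is the player moving first.\<close>

definition attacker_wins ::
  "bool \<Rightarrow> bool \<Rightarrow> bool \<Rightarrow> nat list set \<Rightarrow> (nat list \<Rightarrow> nat list) \<Rightarrow> (nat list \<Rightarrow> nat list) \<Rightarrow> bool" where
  "attacker_wins a b s T \<sigma> \<tau> \<longleftrightarrow>
     (\<exists>n. ends_after T \<sigma> \<tau> n \<and> (if even n = s then a else b))"

text \<open>Each stuck event serves two games. That the first player is stuck is a win for the
  second player in normal play and for the first player in misere play.\<close>

lemma first_stuck_eq:
  "first_stuck = attacker_wins False True False" "first_stuck = attacker_wins True False True"
  by (auto simp: fun_eq_iff first_stuck_def attacker_wins_def)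

lemma second_stuck_eq:
  "second_stuck = attacker_wins False True True" "second_stuck = attacker_wins True False False"
  by (auto simp: fun_eq_iff second_stuck_def attacker_wins_def)

lemma either_stuck_eq: "either_stuck = attacker_wins True True s"
  by (auto simp: fun_eq_iff either_stuck_def first_stuck_def second_stuck_def attacker_wins_def)

text \<open>The move must not depend on the number of moves left. At each vertex the strategy takes
  a child that wins for the least possible bound; by monotonicity that child serves every larger
  bound as well.\<close>

lemma optimal_attack_exists:
  obtains \<rho> where "is_strategy (gw_tree c) \<rho>"
    and "\<And>v n. 0 < c v \<Longrightarrow> win_at a b True (Suc n) c v \<Longrightarrow> win_at a b False n c (\<rho> v)"
proof -
  have "\<exists>w. 0 < c v \<longrightarrow> (\<exists>i<c v. w = v @ [i]) \<and>
          (\<forall>n. win_at a b True (Suc n) c v \<longrightarrow> win_at a b False n c w)" for v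
  proof (cases "0 < c v \<and> (\<exists>n. win_at a b True (Suc n) c v)")
    case True
    define n0 where "n0 = (LEAST n. win_at a b True (Suc n) c v)"
    have "win_at a b True (Suc n0) c v"
      unfolding n0_def using True by (metis LeastI)
    then obtain i where i: "i < c v" "win_at a b False n0 c (v @ [i])"
      using True by (auto simp: win_at_Suc)
    have "n0 \<le> n" if "win_at a b True (Suc n) c v" for n
      unfolding n0_def using that by (rule Least_le)
    with i show ?thesis
      by (blast intro: win_at_mono)
  qed blast
  then obtain \<rho> where \<rho>: "\<And>v. 0 < c v \<longrightarrow> (\<exists>i<c v. \<rho> v = v @ [i]) \<and>
          (\<forall>n. win_at a b True (Suc n) c v \<longrightarrow> win_at a b False n c (\<rho> v))"
    by metis
  show thesis
    by (rule that[of \<rho>]) (use \<rho> in \<open>auto intro: is_strategy_gw_treeI\<close>)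
qed

text \<open>Vertices have finitely many children, so if every child were lost for the defender within
  some number of moves, a common bound would exist.\<close>

lemma optimal_defence_exists:
  obtains \<rho> where "is_strategy (gw_tree c) \<rho>"
    and "\<And>v n. 0 < c v \<Longrightarrow> \<forall>n. \<not> win_at a b False n c v \<Longrightarrow> \<not> win_at a b True n c (\<rho> v)"
proof -
  have "\<exists>w. 0 < c v \<longrightarrow> (\<exists>i<c v. w = v @ [i]) \<and>
          ((\<forall>n. \<not> win_at a b False n c v) \<longrightarrow> (\<forall>n. \<not> win_at a b True n c w))" for v
  proof (cases "0 < c v \<and> (\<forall>n. \<not> win_at a b False n c v)")
    case True
    have "\<exists>i<c v. \<forall>n. \<not> win_at a b True n c (v @ [i])"
    proof (rule ccontr)
      assume "\<not> ?thesis"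
      then obtain f where f: "\<And>i. i < c v \<Longrightarrow> win_at a b True (f i) c (v @ [i])"
        by metis
      have "win_at a b True (Max (f ` {..<c v})) c (v @ [i])" if "i < c v" for i
        using that by (intro win_at_mono[OF f]) auto
      then have "win_at a b False (Suc (Max (f ` {..<c v}))) c v"
        using True by (simp add: win_at_Suc)
      with True show False by blast
    qed
    then show ?thesis by blast
  qed blast
  then obtain \<rho> where \<rho>: "\<And>v. 0 < c v \<longrightarrow> (\<exists>i<c v. \<rho> v = v @ [i]) \<and>
          ((\<forall>n. \<not> win_at a b False n c v) \<longrightarrow> (\<forall>n. \<not> win_at a b True n c (\<rho> v)))"
    by metis
  show thesis
    by (rule that[of \<rho>]) (use \<rho> in \<open>auto intro: is_strategy_gw_treeI\<close>)
qed

text \<open>Each move lowers the bound by one and keeps the position winning, whoever moves. No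
  position is winning for the bound 0, so the play reaches a leaf before, and there
  \<open>win_at_Suc\<close> reads off the winner.\<close>

lemma optimal_attack_wins:
  assumes strat: "is_strategy (gw_tree c) \<sigma>" "is_strategy (gw_tree c) \<tau>"
    and att: "\<And>v n. 0 < c v \<Longrightarrow> win_at a b True (Suc n) c v \<Longrightarrow>
                win_at a b False n c ((if s then \<sigma> else \<tau>) v)"
    and win: "win a b s n c"
  shows "attacker_wins a b s (gw_tree c) \<sigma> \<tau>"
proof -
  let ?T = "gw_tree c"
  have "\<exists>k. ends_after ?T \<sigma> \<tau> k \<and> (if even k = s then a else b)"
    if "\<And>j. j < m \<Longrightarrow> children ?T (play \<sigma> \<tau> j) \<noteq> {}" "win_at a b (even m = s) n c (play \<sigma> \<tau> m)"
    for m n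
    using that
  proof (induction n arbitrary: m)
    case (Suc n)
    have mem: "play \<sigma> \<tau> m \<in> ?T"
      by (rule play_mem_tree[OF strat Suc.prems(1)])
    show ?case
    proof (cases "c (play \<sigma> \<tau> m) = 0")
      case True
      then have "ends_after ?T \<sigma> \<tau> m"
        using Suc.prems(1) mem by (simp add: ends_after_def children_gw_tree_empty_iff)
      then show ?thesis
        using Suc.prems(2) True by (auto simp: win_at_Suc)
    next
      case False
      have nonstuck: "children ?T (play \<sigma> \<tau> j) \<noteq> {}" if "j < Suc m" for j
        using Suc.prems(1) that False mem by (cases "j = m") (auto simp: children_gw_tree_empty_iff)
      have "win_at a b (even (Suc m) = s) n c (play \<sigma> \<tau> (Suc m))"
      proof (cases "even m = s")
        case True
        then show ?thesis
          using att[of "play \<sigma> \<tau> m" n] Suc.prems(2) False by (auto split: if_splits)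
      next
        case turn: False
        obtain i where "i < c (play \<sigma> \<tau> m)" "play \<sigma> \<tau> (Suc m) = play \<sigma> \<tau> m @ [i]"
          using is_strategy_gw_treeD[OF strat(1) mem] is_strategy_gw_treeD[OF strat(2) mem] False
          by (metis gr0I play.simps(2))
        then show ?thesis
          using Suc.prems(2) turn False by (auto simp: win_at_Suc)
      qed
      from Suc.IH[OF nonstuck this] show ?thesis .
    qed
  qed simp
  from this[of 0 n] win show ?thesis
    by (simp add: attacker_wins_def win_at_root)
qed

text \<open>The invariant along the play is that the position is winning for the attacker under no
  bound at all. The defender's strategy preserves it by assumption. A move of the attacker preserves
  it because a child winning for \<open>n\<close> would make the position winning for
  \<open>Suc n\<close>.\<close>

lemma optimal_defence_holds:
  assumes strat: "is_strategy (gw_tree c) \<sigma>" "is_strategy (gw_tree c) \<tau>"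
    and def: "\<And>v n. 0 < c v \<Longrightarrow> \<forall>n. \<not> win_at a b False n c v \<Longrightarrow>
                \<not> win_at a b True n c ((if s then \<tau> else \<sigma>) v)"
    and win: "\<And>n. \<not> win a b s n c"
  shows "\<not> attacker_wins a b s (gw_tree c) \<sigma> \<tau>"
proof
  let ?T = "gw_tree c"
  assume "attacker_wins a b s ?T \<sigma> \<tau>"
  then obtain k where k: "ends_after ?T \<sigma> \<tau> k" "if even k = s then a else b"
    by (auto simp: attacker_wins_def)
  have mem: "play \<sigma> \<tau> m \<in> ?T" if "m \<le> k" for m
    using k(1) that by (intro play_mem_tree[OF strat]) (simp add: ends_after_def)
  have "\<not> win_at a b (even m = s) n c (play \<sigma> \<tau> m)" if "m \<le> k" for m n
    using that
  proof (induction m arbitrary: n)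
    case 0
    then show ?case using win by (simp add: win_at_root)
  next
    case (Suc m)
    have pos: "0 < c (play \<sigma> \<tau> m)"
      using k(1) Suc.prems children_gw_tree_empty_iff[OF mem[of m]] by (simp add: ends_after_def)
    have IH: "\<not> win_at a b (even m = s) n c (play \<sigma> \<tau> m)" for n
      using Suc by simp
    show ?case
    proof (cases "even m = s")
      case False
      then show ?thesis
        using def[OF pos, of n] IH by (auto split: if_splits)
    next
      case True
      obtain i where i: "i < c (play \<sigma> \<tau> m)" "play \<sigma> \<tau> (Suc m) = play \<sigma> \<tau> m @ [i]"
        using is_strategy_gw_treeD[OF strat(1) mem] is_strategy_gw_treeD[OF strat(2) mem] pos Suc.prems
        by (metis Suc_leD play.simps(2))
      then show ?thesis
        using IH[of "Suc n"] True pos by (auto simp: win_at_Suc)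
    qed
  qed
  \<comment> \<open>The bound \<open>Suc 0\<close> allows no move but suffices at a leaf, so a final
    position won by the attacker contradicts the invariant.\<close>
  from this[of k "Suc 0"] k mem[of k] show False
    by (auto simp: win_at_Suc ends_after_def children_gw_tree_empty_iff split: if_splits)
qed

text \<open>If no bound worked, the optimal defence would beat the given strategy. Hence being able
  to force a win already means being able to force it within a bounded number of moves.\<close>

lemma first_has_winning_strategy_iff:
  "first_has_winning_strategy (attacker_wins a b True) (gw_tree c) \<longleftrightarrow> (\<exists>n. win a b True n c)"
proof
  assume "first_has_winning_strategy (attacker_wins a b True) (gw_tree c)"
  then obtain \<sigma> where \<sigma>: "is_strategy (gw_tree c) \<sigma>"
    "\<And>\<tau>. is_strategy (gw_tree c) \<tau> \<Longrightarrow> attacker_wins a b True (gw_tree c) \<sigma> \<tau>"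
    by (auto simp: first_has_winning_strategy_def)
  obtain \<rho> where \<rho>: "is_strategy (gw_tree c) \<rho>"
    "\<And>v n. 0 < c v \<Longrightarrow> \<forall>n. \<not> win_at a b False n c v \<Longrightarrow> \<not> win_at a b True n c (\<rho> v)"
    by (rule optimal_defence_exists[where a = a and b = b and c = c]) (rule that)
  show "\<exists>n. win a b True n c"
    using optimal_defence_holds[of c \<sigma> \<rho> a b True] \<sigma> \<rho> by auto
next
  assume "\<exists>n. win a b True n c"
  then obtain n where n: "win a b True n c" ..
  obtain \<rho> where \<rho>: "is_strategy (gw_tree c) \<rho>"
    "\<And>v n. 0 < c v \<Longrightarrow> win_at a b True (Suc n) c v \<Longrightarrow> win_at a b False n c (\<rho> v)"
    by (rule optimal_attack_exists[where a = a and b = b and c = c]) (rule that)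
  show "first_has_winning_strategy (attacker_wins a b True) (gw_tree c)"
    unfolding first_has_winning_strategy_def
    using optimal_attack_wins[of c \<rho> _ a b True n] \<rho> n by auto
qed

lemma second_has_winning_strategy_iff:
  "second_has_winning_strategy (attacker_wins a b False) (gw_tree c) \<longleftrightarrow> (\<exists>n. win a b False n c)"
proof
  assume "second_has_winning_strategy (attacker_wins a b False) (gw_tree c)"
  then obtain \<tau> where \<tau>: "is_strategy (gw_tree c) \<tau>"
    "\<And>\<sigma>. is_strategy (gw_tree c) \<sigma> \<Longrightarrow> attacker_wins a b False (gw_tree c) \<sigma> \<tau>"
    by (auto simp: second_has_winning_strategy_def)
  obtain \<rho> where \<rho>: "is_strategy (gw_tree c) \<rho>"
    "\<And>v n. 0 < c v \<Longrightarrow> \<forall>n. \<not> win_at a b False n c v \<Longrightarrow> \<not> win_at a b True n c (\<rho> v)"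
    by (rule optimal_defence_exists[where a = a and b = b and c = c]) (rule that)
  show "\<exists>n. win a b False n c"
    using optimal_defence_holds[of c \<rho> \<tau> a b False] \<tau> \<rho> by auto
next
  assume "\<exists>n. win a b False n c"
  then obtain n where n: "win a b False n c" ..
  obtain \<rho> where \<rho>: "is_strategy (gw_tree c) \<rho>"
    "\<And>v n. 0 < c v \<Longrightarrow> win_at a b True (Suc n) c v \<Longrightarrow> win_at a b False n c (\<rho> v)"
    by (rule optimal_attack_exists[where a = a and b = b and c = c]) (rule that)
  show "second_has_winning_strategy (attacker_wins a b False) (gw_tree c)"
    unfolding second_has_winning_strategy_def
    using optimal_attack_wins[of c _ \<rho> a b False n] \<rho> n by auto
qed

subsection \<open>Generating functions and win probabilities\<close>

definition pgf :: "nat pmf \<Rightarrow> real \<Rightarrow> real" where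
  "pgf p x = (\<Sum>\<^sub>\<infinity>k. pmf p k * x ^ k)"

lemma summable_on_pgf:
  assumes "0 \<le> x" "x \<le> 1"
  shows "(\<lambda>k. pmf p k * x ^ k) summable_on UNIV"
proof (rule summable_on_comparison_test[OF summable_on_pmf[of p UNIV]])
  show "pmf p k * x ^ k \<le> pmf p k" for k
    using assms by (intro mult_left_le power_le_one) auto
qed (use assms in auto)

lemma pgf_sums:
  assumes "0 \<le> x" "x \<le> 1"
  shows "(\<lambda>k. pmf p k * x ^ k) sums pgf p x"
  unfolding pgf_def
  by (intro has_sum_imp_sums has_sum_infsum summable_on_pgf assms)

lemma pgf_0 [simp]: "pgf p 0 = pmf p 0"
  using sums_unique2[OF pgf_sums powser_sums_zero] by simp

lemma pgf_1 [simp]: "pgf p 1 = 1"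
proof -
  have "infsetsum (pmf p) UNIV = 1"
    by (rule infsetsum_pmf_eq_1) simp
  then show ?thesis
    using infsetsum_infsum[OF pmf_abs_summable, of p UNIV] by (simp add: pgf_def)
qed

lemma pgf_mono:
  assumes "0 \<le> x" "x \<le> y" "y \<le> 1"
  shows "pgf p x \<le> pgf p y"
  unfolding pgf_def
  using assms by (intro infsum_mono summable_on_pgf mult_left_mono power_mono) auto

text \<open>The weights themselves are a summable majorant on the closed interval, so continuity
  includes the endpoint 1.\<close>

lemma continuous_on_pgf: "continuous_on {0..1} (pgf p)"
proof -
  have "uniform_limit {0..1} (\<lambda>n x. \<Sum>k<n. pmf p k * x ^ k) (\<lambda>x. \<Sum>k. pmf p k * x ^ k) sequentially"
  proof (rule Weierstrass_m_test)
    show "norm (pmf p k * x ^ k) \<le> pmf p k" if "x \<in> {0..1}" for k and x :: real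
      using that by (auto simp: power_le_one mult_left_le abs_mult)
    show "summable (pmf p)"
      using pgf_sums[of 1 p] by (auto simp: summable_def)
  qed
  then have "continuous_on {0..1} (\<lambda>x. \<Sum>k. pmf p k * x ^ k)"
    by (rule uniform_limit_theorem[rotated]) (auto intro!: always_eventually continuous_intros)
  then show ?thesis
    by (rule continuous_on_eq) (use pgf_sums in \<open>auto simp: sums_iff\<close>)
qed

section \<open>Independence of the root label and the subtrees\<close>

lemma prob_space_gw_space: "prob_space (gw_space p)"
  unfolding gw_space_def by (intro prob_space_PiM measure_pmf.prob_space_axioms)

lemma space_gw_space [simp]: "space (gw_space p) = UNIV"
  by (simp add: gw_space_def space_PiM)

lemma measurable_label [measurable]: "(\<lambda>c. c v) \<in> measurable (gw_space p) (count_space UNIV)"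
proof -
  have "(\<lambda>c. c v) \<in> measurable (gw_space p) (measure_pmf p)"
    unfolding gw_space_def by (rule measurable_component_singleton) simp
  then show ?thesis by simp
qed

lemma measurable_subtree [measurable]: "(\<lambda>c v. c (i # v)) \<in> measurable (gw_space p) (gw_space p)"
  unfolding gw_space_def
  by (rule measurable_PiM_single')
     (use measurable_label in \<open>auto simp: space_PiM gw_space_def\<close>)

text \<open>Prefixing \<open>i\<close> is injective on vertices, and reindexing a product of
  identical factors along an injection preserves the law: the subtree at a child is again
  Galton-Watson.\<close>

lemma distr_subtree: "distr (gw_space p) (gw_space p) (\<lambda>c v. c (i # v)) = gw_space p"
  using distr_PiM_reindex[of UNIV "\<lambda>_. measure_pmf p" "(#) i" UNIV]
  by (simp add: gw_space_def measure_pmf.prob_space_axioms restrict_def)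

lemma distr_label: "distr (gw_space p) (measure_pmf p) (\<lambda>c. c v) = measure_pmf p"
  unfolding gw_space_def by (rule distr_PiM_component) (auto intro: measure_pmf.prob_space_axioms)

lemma measure_subtree:
  assumes "S \<in> sets (gw_space p)"
  shows "measure (gw_space p) {c. (\<lambda>v. c (i # v)) \<in> S} = measure (gw_space p) S"
proof -
  have "measure (distr (gw_space p) (gw_space p) (\<lambda>c v. c (i # v))) S
      = measure (gw_space p) {c. (\<lambda>v. c (i # v)) \<in> S}"
    by (subst measure_distr[OF measurable_subtree assms]) (simp add: vimage_def)
  then show ?thesis
    by (simp add: distr_subtree)
qed

lemma measure_label: "measure (gw_space p) {c. c v = k} = pmf p k"
proof -
  have "measure (distr (gw_space p) (measure_pmf p) (\<lambda>c. c v)) {k} = measure (gw_space p) {c. c v = k}"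
    by (subst measure_distr) (auto simp: vimage_def)
  then show ?thesis
    by (simp add: distr_label measure_pmf_single)
qed

lemma indep_vars_label:
  "prob_space.indep_vars (gw_space p) (\<lambda>_. measure_pmf p) (\<lambda>v c. c v) UNIV"
proof -
  interpret prob_space "gw_space p" by (rule prob_space_gw_space)
  have "distr (gw_space p) (Pi\<^sub>M UNIV (\<lambda>_. measure_pmf p)) (\<lambda>c. c) = gw_space p"
    by (simp add: gw_space_def distr_id2)
  then show ?thesis
    by (subst indep_vars_iff_distr_eq_PiM) (simp_all add: distr_label restrict_def, simp add: gw_space_def)
qed

text \<open>This is the branching property. Fixing the root label to \<open>k\<close> leaves a fixed
  finite number of subtrees, and these and the root depend on disjoint sets of labels.\<close>

lemma measure_label_subtrees:
  assumes S: "S \<in> sets (gw_space p)"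
  shows "measure (gw_space p) {c. c [] = k \<and> (\<forall>i<k. (\<lambda>v. c (i # v)) \<in> S)}
       = pmf p k * measure (gw_space p) S ^ k"
proof -
  interpret prob_space "gw_space p" by (rule prob_space_gw_space)
  \<comment> \<open>The blocks of vertices: \<open>None\<close> stands for the root alone,
    \<open>Some i\<close> for all words starting with \<open>i\<close>. Restrictions of an
    independent family to disjoint blocks are independent.\<close>
  let ?K = "case_option {[]} (\<lambda>i. range ((#) i)) :: nat option \<Rightarrow> nat list set"
  let ?M = "\<lambda>j. Pi\<^sub>M (?K j) (\<lambda>_. measure_pmf p)"
  let ?X = "\<lambda>j c. restrict (\<lambda>v. c v) (?K j)"
  let ?A = "\<lambda>j. case j of None \<Rightarrow> {f \<in> space (?M None). f [] = k}
                | Some i \<Rightarrow> {f \<in> space (?M (Some i)). (\<lambda>v. f (i # v)) \<in> S}"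
  let ?J = "insert None (Some ` {..<k})"
  have ind: "indep_vars ?M ?X UNIV"
    by (rule indep_vars_restrict[OF indep_vars_label])
       (auto simp: disjoint_family_on_def split: option.splits)
  have sub: "(\<lambda>f v. f (i # v)) \<in> measurable (?M (Some i)) (gw_space p)" for i
    unfolding gw_space_def option.case
  proof (rule measurable_PiM_single')
    show "(\<lambda>f. f (i # v)) \<in> measurable (Pi\<^sub>M (range ((#) i)) (\<lambda>_. measure_pmf p)) (measure_pmf p)" for v
      by (rule measurable_component_singleton) simp
  qed (simp add: space_PiM)
  have A: "?A j \<in> sets (?M j)" for j
  proof (cases j)
    case None
    have "(\<lambda>f. f []) \<in> measurable (?M None) (measure_pmf p)"
      by (rule measurable_component_singleton) simp
    then have "(\<lambda>f. f []) -` {k} \<inter> space (?M None) \<in> sets (?M None)"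
      by (rule measurable_sets) simp
    then show ?thesis
      by (simp add: None vimage_def Int_def conj_commute)
  next
    case (Some i)
    then show ?thesis
      using measurable_sets[OF sub[of i] S] by (simp add: vimage_def Int_def conj_commute)
  qed
  have XA_None: "?X None -` ?A None \<inter> space (gw_space p) = {c. c [] = k}"
    by (auto simp: space_PiM)
  have XA_Some: "?X (Some i) -` ?A (Some i) \<inter> space (gw_space p) = {c. (\<lambda>v. c (i # v)) \<in> S}" for i
    by (auto simp: space_PiM)
  have "prob (\<Inter>j\<in>?J. ?X j -` ?A j \<inter> space (gw_space p))
      = (\<Prod>j\<in>?J. prob (?X j -` ?A j \<inter> space (gw_space p)))"
    by (rule indep_varsD[OF ind]) (use A in auto)
  also have "\<dots> = prob (?X None -` ?A None \<inter> space (gw_space p)) *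
      (\<Prod>i<k. prob (?X (Some i) -` ?A (Some i) \<inter> space (gw_space p)))"
    by (subst prod.insert) (auto simp: prod.reindex simp del: space_gw_space)
  also have "\<dots> = pmf p k * measure (gw_space p) S ^ k"
    unfolding XA_None XA_Some by (simp add: measure_label measure_subtree[OF S])
  also have "(\<Inter>j\<in>?J. ?X j -` ?A j \<inter> space (gw_space p))
      = {c. c [] = k \<and> (\<forall>i<k. (\<lambda>v. c (i # v)) \<in> S)}"
    by (auto simp: space_PiM)
  finally show ?thesis .
qed

lemma sets_all_subtrees:
  assumes [measurable]: "S \<in> sets (gw_space p)"
  shows "{c. \<forall>i<c []. (\<lambda>v. c (i # v)) \<in> S} \<in> sets (gw_space p)"
proof -
  have "{c \<in> space (gw_space p). \<forall>i<c []. (\<lambda>v. c (i # v)) \<in> S} \<in> sets (gw_space p)"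
    by measurable
  then show ?thesis by simp
qed

lemma measure_all_subtrees:
  assumes S: "S \<in> sets (gw_space p)"
  shows "measure (gw_space p) {c. \<forall>i<c []. (\<lambda>v. c (i # v)) \<in> S} = pgf p (measure (gw_space p) S)"
proof -
  interpret prob_space "gw_space p" by (rule prob_space_gw_space)
  let ?A = "\<lambda>k. {c. c [] = k \<and> (\<forall>i<k. (\<lambda>v. c (i # v)) \<in> S)}"
  have "{c \<in> space (gw_space p). c [] = k \<and> (\<forall>i<k. (\<lambda>v. c (i # v)) \<in> S)} \<in> sets (gw_space p)" for k
    using S by measurable
  then have "range ?A \<subseteq> sets (gw_space p)"
    by auto
  then have "(\<lambda>k. prob (?A k)) sums prob (\<Union>k. ?A k)"
    by (intro finite_measure_UNION) (auto simp: disjoint_family_on_def)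
  moreover have "(\<Union>k. ?A k) = {c. \<forall>i<c []. (\<lambda>v. c (i # v)) \<in> S}"
    by auto
  ultimately show ?thesis
    using pgf_sums[of "prob S" p] by (simp add: measure_label_subtrees[OF S] sums_unique2)
qed

section \<open>Recursion and limit of the win probabilities\<close>

lemma sets_win: "{c. win a b t n c} \<in> sets (gw_space p)"
proof (induction n arbitrary: t)
  case (Suc n)
  have [measurable]: "Measurable.pred (gw_space p) (win a b t n)" for t
    using Suc by (simp add: pred_def)
  have "{c \<in> space (gw_space p). win a b t (Suc n) c} \<in> sets (gw_space p)"
    unfolding win.simps by measurable
  then show ?case by simp
qed (simp add: win_0)

text \<open>The attacker to move fails iff he fails at every child, and the defender to move loses
  iff he loses at every child; both become values of \<open>pgf\<close>. A leaf satisfies such a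
  condition vacuously, so \<open>pmf p 0\<close> is subtracted exactly when the rules give a leaf
  the opposite outcome.\<close>

fun win_prob :: "bool \<Rightarrow> bool \<Rightarrow> nat pmf \<Rightarrow> bool \<Rightarrow> nat \<Rightarrow> real" where
  "win_prob a b p t 0 = 0"
| "win_prob a b p True (Suc n) =
     1 - (pgf p (1 - win_prob a b p False n) - of_bool a * pmf p 0)"
| "win_prob a b p False (Suc n) = pgf p (win_prob a b p True n) - of_bool (\<not> b) * pmf p 0"

lemma measure_nonleaf_all_subtrees:
  assumes S: "S \<in> sets (gw_space p)"
  shows "measure (gw_space p) {c. (c [] = 0 \<longrightarrow> e) \<and> (\<forall>i<c []. (\<lambda>v. c (i # v)) \<in> S)}
       = pgf p (measure (gw_space p) S) - of_bool (\<not> e) * pmf p 0"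
proof (cases e)
  case True
  then show ?thesis by (simp add: measure_all_subtrees[OF S])
next
  case False
  interpret prob_space "gw_space p" by (rule prob_space_gw_space)
  have "{c \<in> space (gw_space p). c [] = 0} \<in> sets (gw_space p)"
    by measurable
  then have leaf: "{c. c [] = (0::nat)} \<in> sets (gw_space p)"
    by simp
  have "{c. (c [] = 0 \<longrightarrow> e) \<and> (\<forall>i<c []. (\<lambda>v. c (i # v)) \<in> S)}
      = {c. \<forall>i<c []. (\<lambda>v. c (i # v)) \<in> S} - {c. c [] = 0}"
    using False by auto
  then show ?thesis
    using False finite_measure_Diff[OF sets_all_subtrees[OF S] leaf]
    by (simp add: measure_all_subtrees[OF S] measure_label Collect_mono)
qed

lemma measure_win: "measure (gw_space p) {c. win a b t n c} = win_prob a b p t n"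
proof (induction n arbitrary: t)
  case (Suc n)
  interpret prob_space "gw_space p" by (rule prob_space_gw_space)
  have compl: "prob {c. \<not> win a b t n c} = 1 - prob {c. win a b t n c}" for t n
    using prob_compl[OF sets_win[of a b t n p]] by (simp add: Collect_neg_eq Compl_eq_Diff_UNIV)
  show ?case
  proof (cases t)
    case False
    have "{c. win a b False (Suc n) c}
        = {c. (c [] = 0 \<longrightarrow> b) \<and> (\<forall>i<c []. (\<lambda>v. c (i # v)) \<in> {c. win a b True n c})}"
      by auto
    with False show ?thesis
      by (simp only: measure_nonleaf_all_subtrees[OF sets_win] Suc win_prob.simps)
  next
    case True
    have "{c. \<not> win a b False n c} \<in> sets (gw_space p)"
      using sets.compl_sets[OF sets_win[of a b False n p]] by (simp add: Collect_neg_eq Compl_eq_Diff_UNIV)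
    \<comment> \<open>The complement turns the attacker's choice of one child into a condition on
      all children, to which independence applies.\<close>
    moreover have "{c. \<not> win a b True (Suc n) c}
        = {c. (c [] = 0 \<longrightarrow> \<not> a) \<and> (\<forall>i<c []. (\<lambda>v. c (i # v)) \<in> {c. \<not> win a b False n c})}"
      by auto
    ultimately have "prob {c. \<not> win a b True (Suc n) c}
        = pgf p (1 - win_prob a b p False n) - of_bool a * pmf p 0"
      by (simp only: measure_nonleaf_all_subtrees compl Suc not_not)
    with True show ?thesis
      by (simp add: compl del: win.simps)
  qed
qed (simp add: win_0)

definition win_value :: "bool \<Rightarrow> bool \<Rightarrow> nat pmf \<Rightarrow> bool \<Rightarrow> real" where
  "win_value a b p t = gw_prob p (if t then first_has_winning_strategy (attacker_wins a b True)
                                  else second_has_winning_strategy (attacker_wins a b False))"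

lemma outcome_eq_win_value:
  "normal_N p = win_value False True p True"
  "normal_P p = win_value False True p False"
  "misere_N p = win_value True False p True"
  "misere_P p = win_value True False p False"
  "stopper_S1 p = win_value True True p True"
  "stopper_S2 p = win_value True True p False"
  by (simp_all add: win_value_def normal_N_def normal_P_def misere_N_def misere_P_def
      stopper_S1_def stopper_S2_def first_stuck_eq(1) second_stuck_eq(1)
      flip: first_stuck_eq second_stuck_eq either_stuck_eq)

lemma win_value_eq: "win_value a b p t = measure (gw_space p) {c. \<exists>n. win a b t n c}"
  by (simp add: win_value_def gw_prob_def first_has_winning_strategy_iff
      second_has_winning_strategy_iff)

lemma win_prob_mono: "n \<le> m \<Longrightarrow> win_prob a b p t n \<le> win_prob a b p t m"
proof -
  interpret prob_space "gw_space p" by (rule prob_space_gw_space)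
  show "n \<le> m \<Longrightarrow> win_prob a b p t n \<le> win_prob a b p t m"
    unfolding measure_win[symmetric] by (intro finite_measure_mono sets_win) (auto intro: win_mono)
qed

lemma win_prob_bounds: "0 \<le> win_prob a b p t n" "win_prob a b p t n \<le> 1"
  unfolding measure_win[symmetric]
  by (simp_all add: prob_space.prob_le_1[OF prob_space_gw_space])

lemma win_prob_tendsto: "win_prob a b p t \<longlonglongrightarrow> win_value a b p t"
proof -
  interpret prob_space "gw_space p" by (rule prob_space_gw_space)
  have "(\<lambda>n. prob {c. win a b t n c}) \<longlonglongrightarrow> prob (\<Union>n. {c. win a b t n c})"
    by (rule finite_Lim_measure_incseq) (auto simp: sets_win incseq_def intro: win_mono)
  then show ?thesis
    by (simp add: measure_win win_value_eq Collect_ex_eq)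
qed

lemma win_prob_le_win_value: "win_prob a b p t n \<le> win_value a b p t"
  by (rule incseq_le[OF _ win_prob_tendsto]) (simp add: incseq_def win_prob_mono)

lemma win_value_bounds: "0 \<le> win_value a b p t" "win_value a b p t \<le> 1"
  unfolding win_value_eq by (simp_all add: prob_space.prob_le_1[OF prob_space_gw_space])

lemma tendsto_pgf:
  assumes "(f \<longlongrightarrow> l) F" "\<And>n. 0 \<le> f n" "\<And>n. f n \<le> 1" "0 \<le> l" "l \<le> 1"
  shows "((\<lambda>n. pgf p (f n)) \<longlongrightarrow> pgf p l) F"
  by (rule continuous_on_tendsto_compose[OF continuous_on_pgf assms(1)]) (use assms in auto)

lemma win_value_True:
  "win_value a b p True = 1 - (pgf p (1 - win_value a b p False) - of_bool a * pmf p 0)"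
proof (rule LIMSEQ_unique)
  show "(\<lambda>n. win_prob a b p True (Suc n)) \<longlonglongrightarrow> win_value a b p True"
    by (rule LIMSEQ_Suc[OF win_prob_tendsto])
  show "(\<lambda>n. win_prob a b p True (Suc n)) \<longlonglongrightarrow>
      1 - (pgf p (1 - win_value a b p False) - of_bool a * pmf p 0)"
    unfolding win_prob.simps
    by (intro tendsto_diff tendsto_const tendsto_pgf win_prob_tendsto)
       (use win_prob_bounds win_value_bounds in auto)
qed

lemma win_value_False:
  "win_value a b p False = pgf p (win_value a b p True) - of_bool (\<not> b) * pmf p 0"
proof (rule LIMSEQ_unique)
  show "(\<lambda>n. win_prob a b p False (Suc n)) \<longlonglongrightarrow> win_value a b p False"
    by (rule LIMSEQ_Suc[OF win_prob_tendsto])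
  show "(\<lambda>n. win_prob a b p False (Suc n)) \<longlonglongrightarrow>
      pgf p (win_value a b p True) - of_bool (\<not> b) * pmf p 0"
    unfolding win_prob.simps
    by (intro tendsto_diff tendsto_const tendsto_pgf win_prob_tendsto)
       (use win_prob_bounds win_value_bounds in auto)
qed

text \<open>By induction on the bound, a supersolution dominates the iterates starting from 0. The
  defender's side is given by its complement \<open>v\<close>; for \<open>b = (\<not> a)\<close> the
  two conditions then concern one decreasing map \<open>F\<close> and read
  \<open>F v \<le> u\<close> and \<open>v \<le> F u\<close>.\<close>

lemma win_value_least:
  assumes "0 \<le> u" "u \<le> 1" "0 \<le> v" "v \<le> 1"
    and u: "1 - (pgf p v - of_bool a * pmf p 0) \<le> u"
    and v: "pgf p u - of_bool (\<not> b) * pmf p 0 \<le> 1 - v"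
  shows "win_value a b p True \<le> u" "win_value a b p False \<le> 1 - v"
proof -
  have *: "win_prob a b p True n \<le> u \<and> win_prob a b p False n \<le> 1 - v" for n
  proof (induction n)
    case (Suc n)
    have "pgf p v \<le> pgf p (1 - win_prob a b p False n)"
      using Suc assms win_prob_bounds[of a b p False n] by (intro pgf_mono) auto
    moreover have "pgf p (win_prob a b p True n) \<le> pgf p u"
      using Suc assms win_prob_bounds[of a b p True n] by (intro pgf_mono) auto
    ultimately show ?case
      using u v by auto
  qed (use assms in auto)
  show "win_value a b p True \<le> u" "win_value a b p False \<le> 1 - v"
    using * by (auto intro: LIMSEQ_le_const2[OF win_prob_tendsto])
qed

subsection \<open>Semicontinuity\<close>

interpretation M0: Metric_space UNIV d0
  by (rule Metric_space_d0)

interpretation M1: Metric_space M1 d1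
  by (rule Metric_space_d1)

lemma topspace_M0_topology [simp]: "topspace M0_topology = UNIV"
  by (simp add: M0_topology_def)

lemma topspace_M1_topology [simp]: "topspace M1_topology = M1"
  by (simp add: M1_topology_def)

lemma pmf_le_add_d0: "pmf p k \<le> pmf q k + d0 p q"
proof -
  have "(\<Sum>i\<in>{k}. \<bar>pmf p i - pmf q i\<bar>) \<le> d0 p q"
    unfolding d0_def by (intro finite_sum_le_infsum summable_on_diff_pmf) auto
  then show ?thesis by simp
qed

lemma abs_pmf_diff_le_d0: "\<bar>pmf p k - pmf q k\<bar> \<le> d0 p q"
  using pmf_le_add_d0[of p k q] pmf_le_add_d0[of q k p] M0.commute[of p q] by simp

text \<open>The bound is uniform in \<open>x\<close>, so in \<open>continuous_map_pgf\<close> the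
  argument may vary together with the distribution.\<close>

lemma pgf_le_add_d0:
  assumes "0 \<le> x" "x \<le> 1"
  shows "pgf p x \<le> pgf q x + d0 p q"
proof -
  have "pgf p x \<le> (\<Sum>\<^sub>\<infinity>k. pmf q k * x ^ k + \<bar>pmf p k - pmf q k\<bar>)"
    unfolding pgf_def
  proof (rule infsum_mono)
    show "(\<lambda>k. pmf q k * x ^ k + \<bar>pmf p k - pmf q k\<bar>) summable_on UNIV"
      by (intro summable_on_add summable_on_pgf summable_on_diff_pmf assms)
    show "pmf p k * x ^ k \<le> pmf q k * x ^ k + \<bar>pmf p k - pmf q k\<bar>" for k
    proof -
      have "(pmf p k - pmf q k) * x ^ k \<le> \<bar>pmf p k - pmf q k\<bar> * x ^ k"
        using assms by (intro mult_right_mono) auto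
      also have "\<dots> \<le> \<bar>pmf p k - pmf q k\<bar>"
        using assms by (intro mult_left_le power_le_one) auto
      finally show ?thesis by (simp add: algebra_simps)
    qed
  qed (intro summable_on_pgf assms)
  also have "\<dots> = pgf q x + d0 p q"
    unfolding pgf_def d0_def by (intro infsum_add summable_on_pgf summable_on_diff_pmf assms)
  finally show ?thesis .
qed

lemma abs_pgf_diff_le_d0:
  "0 \<le> x \<Longrightarrow> x \<le> 1 \<Longrightarrow> \<bar>pgf p x - pgf q x\<bar> \<le> d0 p q"
  using pgf_le_add_d0[of x p q] pgf_le_add_d0[of x q p] M0.commute[of p q] by simp

lemma tendsto_d0: "((\<lambda>q. d0 q p) \<longlongrightarrow> 0) (atin M0_topology p)"
proof (rule tendstoI)
  fix e :: real assume "0 < e"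
  then show "\<forall>\<^sub>F q in atin M0_topology p. dist (d0 q p) 0 < e"
    unfolding M0_topology_def M0.eventually_atin_metric by (auto intro!: exI[of _ e])
qed

lemma continuous_map_pmf: "continuous_map M0_topology euclideanreal (\<lambda>p. pmf p k)"
  unfolding continuous_map_atin limitin_canonical_iff
proof
  fix p
  have "((\<lambda>q. pmf q k - pmf p k) \<longlongrightarrow> 0) (atin M0_topology p)"
    by (rule Lim_null_comparison[OF _ tendsto_d0]) (simp add: abs_pmf_diff_le_d0)
  then show "((\<lambda>q. pmf q k) \<longlongrightarrow> pmf p k) (atin M0_topology p)"
    by (rule LIM_zero_cancel)
qed

lemma continuous_map_pgf:
  assumes f: "continuous_map M0_topology euclideanreal f" and f01: "\<And>p. 0 \<le> f p" "\<And>p. f p \<le> 1"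
  shows "continuous_map M0_topology euclideanreal (\<lambda>p. pgf p (f p))"
  unfolding continuous_map_atin limitin_canonical_iff
proof
  fix p
  have "((\<lambda>q. pgf q (f q) - pgf p (f q)) \<longlongrightarrow> 0) (atin M0_topology p)"
    by (rule Lim_null_comparison[OF _ tendsto_d0]) (simp add: abs_pgf_diff_le_d0 f01)
  moreover have "((\<lambda>q. pgf p (f q)) \<longlongrightarrow> pgf p (f p)) (atin M0_topology p)"
    using f by (intro tendsto_pgf f01) (simp add: continuous_map_atin)
  ultimately have "((\<lambda>q. (pgf q (f q) - pgf p (f q)) + pgf p (f q)) \<longlongrightarrow> 0 + pgf p (f p))
      (atin M0_topology p)"
    by (rule tendsto_add)
  then show "((\<lambda>q. pgf q (f q)) \<longlongrightarrow> pgf p (f p)) (atin M0_topology p)"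
    by simp
qed

lemma continuous_map_win_prob:
  "continuous_map M0_topology euclideanreal (\<lambda>p. win_prob a b p t n)"
proof (induction n arbitrary: t)
  case (Suc n)
  show ?case
  proof (cases t)
    case True
    have "continuous_map M0_topology euclideanreal (\<lambda>p. pgf p (1 - win_prob a b p False n))"
      by (intro continuous_map_pgf continuous_map_diff Suc)
         (auto simp: win_prob_bounds)
    then show ?thesis
      using True
      by (auto intro!: continuous_map_diff continuous_map_real_mult continuous_map_pmf)
  next
    case False
    have "continuous_map M0_topology euclideanreal (\<lambda>p. pgf p (win_prob a b p True n))"
      by (intro continuous_map_pgf Suc) (auto simp: win_prob_bounds)
    then show ?thesis
      using False
      by (auto intro!: continuous_map_diff continuous_map_real_mult continuous_map_pmf)
  qed
qed simp

lemma lower_semicontinuous_map_win_value: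
  "lower_semicontinuous_map M0_topology (\<lambda>p. win_value a b p t)"
  unfolding lower_semicontinuous_map_def
proof
  fix x
  have "x < win_value a b p t \<longleftrightarrow> (\<exists>n. x < win_prob a b p t n)" for p
  proof
    assume "x < win_value a b p t"
    then have "\<forall>\<^sub>F n in sequentially. x < win_prob a b p t n"
      by (rule order_tendstoD(1)[OF win_prob_tendsto])
    then show "\<exists>n. x < win_prob a b p t n"
      by (rule eventually_happens'[OF sequentially_bot])
  qed (use win_prob_le_win_value less_le_trans in blast)
  then have "{p \<in> topspace M0_topology. x < win_value a b p t}
      = (\<Union>n. {p \<in> topspace M0_topology. x < win_prob a b p t n})"
    by auto
  moreover have "openin M0_topology {p \<in> topspace M0_topology. x < win_prob a b p t n}" for n
    using continuous_map_win_prob[of a b t n]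
    unfolding continuous_map_upper_lower_semicontinuous_lt by blast
  ultimately show "openin M0_topology {p \<in> topspace M0_topology. x < win_value a b p t}"
    by auto
qed

section \<open>Sums and complements of semicontinuous functions, and draw probabilities\<close>

lemma lower_semicontinuous_map_add:
  assumes f: "lower_semicontinuous_map X f" and g: "lower_semicontinuous_map X g"
  shows "lower_semicontinuous_map X (\<lambda>x. f x + g x)"
  unfolding lower_semicontinuous_map_def
proof
  fix a
  have "{x \<in> topspace X. a < f x + g x}
      = (\<Union>r. {x \<in> topspace X. r < f x} \<inter> {x \<in> topspace X. a - r < g x})"
  proof (intro equalityI subsetI)
    fix x assume "x \<in> {x \<in> topspace X. a < f x + g x}"
    then show "x \<in> (\<Union>r. {x \<in> topspace X. r < f x} \<inter> {x \<in> topspace X. a - r < g x})"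
      \<comment> \<open>This \<open>r\<close> shares the excess of \<open>f x + g x\<close> over
        \<open>a\<close> equally between the two strict inequalities.\<close>
      by (auto intro!: exI[of _ "f x - (f x + g x - a) / 2"] simp: field_simps)
  qed auto
  moreover have "openin X ({x \<in> topspace X. r < f x} \<inter> {x \<in> topspace X. a - r < g x})" for r
    using f g by (intro openin_Int) (auto simp: lower_semicontinuous_map_def)
  ultimately show "openin X {x \<in> topspace X. a < f x + g x}"
    by auto
qed

lemma upper_semicontinuous_map_one_minus:
  assumes "lower_semicontinuous_map X f"
  shows "upper_semicontinuous_map X (\<lambda>x. 1 - f x)"
proof -
  have "{x \<in> topspace X. 1 - f x < a} = {x \<in> topspace X. 1 - a < f x}" for a
    by auto
  with assms show ?thesis
    by (simp add: lower_semicontinuous_map_def upper_semicontinuous_map_def)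
qed

text \<open>On \<open>S\<close> the function \<open>f\<close> equals \<open>1 - g\<close>, hence is
  upper semicontinuous there too.\<close>

lemma continuous_map_complementary_lower_semicontinuous:
  assumes f: "lower_semicontinuous_map X f" and g: "lower_semicontinuous_map X g"
    and S: "\<And>x. x \<in> S \<Longrightarrow> f x + g x = 1"
  shows "continuous_map (subtopology X S) euclideanreal f"
  unfolding continuous_map_upper_lower_semicontinuous_lt
proof (intro conjI allI)
  fix a
  have "{x \<in> topspace (subtopology X S). a < f x} = {x \<in> topspace X. a < f x} \<inter> S"
    by auto
  then show "openin (subtopology X S) {x \<in> topspace (subtopology X S). a < f x}"
    using f unfolding openin_subtopology lower_semicontinuous_map_def by blast
  have "{x \<in> topspace (subtopology X S). f x < a} = {x \<in> topspace X. 1 - a < g x} \<inter> S"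
    using S by force
  then show "openin (subtopology X S) {x \<in> topspace (subtopology X S). f x < a}"
    using g unfolding openin_subtopology lower_semicontinuous_map_def by blast
qed

text \<open>With \<open>b = (\<not> a)\<close> the rule is the same for both players, so the two win
  values belong to Next and Previous in one game: normal play for \<open>a = False\<close>, misere
  play for \<open>a = True\<close>.\<close>

definition draw_value :: "bool \<Rightarrow> nat pmf \<Rightarrow> real" where
  "draw_value a p = 1 - win_value a (\<not> a) p True - win_value a (\<not> a) p False"

lemma draw_eq: "normal_D = draw_value False" "misere_D = draw_value True"
  by (simp_all add: fun_eq_iff normal_D_def misere_D_def draw_value_def outcome_eq_win_value)

lemma upper_semicontinuous_map_draw_value:
  "upper_semicontinuous_map M0_topology (draw_value a)"
proof -
  have "draw_value a = (\<lambda>p. 1 - (win_value a (\<not> a) p True + win_value a (\<not> a) p False))"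
    by (auto simp: draw_value_def)
  then show ?thesis
    by (simp only: upper_semicontinuous_map_one_minus lower_semicontinuous_map_add
        lower_semicontinuous_map_win_value)
qed

lemma continuous_map_win_value_no_draw:
  "continuous_map (subtopology M0_topology {p. draw_value a p = 0}) euclideanreal
     (\<lambda>p. win_value a (\<not> a) p t)"
  by (rule continuous_map_complementary_lower_semicontinuous[where g = "\<lambda>p. win_value a (\<not> a) p (\<not> t)"])
     (cases t; auto simp: draw_value_def lower_semicontinuous_map_win_value)+

text \<open>Next's bounded win probability and the complement of Previous' one are obtained from
  each other's predecessors by the same decreasing map. It thus carries their order from one bound
  to the next, and then to the limit.\<close>

lemma draw_value_nonneg: "0 \<le> draw_value a p"
proof -
  have *: "win_prob a (\<not> a) p True n \<le> 1 - win_prob a (\<not> a) p False n" for n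
  proof (induction n)
    case (Suc n)
    have "pgf p (win_prob a (\<not> a) p True n) \<le> pgf p (1 - win_prob a (\<not> a) p False n)"
      by (intro pgf_mono Suc) (simp_all add: win_prob_bounds)
    then show ?case by simp
  qed simp
  have "win_value a (\<not> a) p True \<le> 1 - win_value a (\<not> a) p False"
    by (rule LIMSEQ_le[OF win_prob_tendsto tendsto_diff[OF tendsto_const win_prob_tendsto]])
       (use * in blast)
  then show ?thesis by (simp add: draw_value_def)
qed

subsection \<open>Binary branching\<close>

lemma pgf_binary:
  assumes "set_pmf p \<subseteq> {0, 1, 2}" "0 \<le> x" "x \<le> 1"
  shows "pgf p x = pmf p 0 + pmf p 1 * x + pmf p 2 * x\<^sup>2"
proof -
  have "(\<lambda>k. pmf p k * x ^ k) sums (\<Sum>k\<in>{0, 1, 2}. pmf p k * x ^ k)"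
    by (rule sums_finite) (use assms(1) in \<open>auto simp: pmf_eq_0_set_pmf\<close>)
  with pgf_sums[OF assms(2,3)] show ?thesis
    using sums_unique2 by fastforce
qed

text \<open>The sum and the squared difference of the two points of a genuine 2-cycle of the quadratic
  map \<open>x \<mapsto> k - p\<^sub>1 x - p\<^sub>2 x\<^sup>2\<close>.\<close>

definition cycle_sum :: "real \<Rightarrow> real \<Rightarrow> real" where
  "cycle_sum p1 p2 = (1 - p1) / p2"

definition cycle_discr :: "real \<Rightarrow> real \<Rightarrow> real \<Rightarrow> real" where
  "cycle_discr k p1 p2 =
     2 / p2 * (2 * k - cycle_sum p1 p2 * (1 + p1)) - (cycle_sum p1 p2)\<^sup>2"

text \<open>Subtracting the two equations and cancelling \<open>v - u\<close> gives the sum. Adding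
  them gives the sum of squares, hence the squared difference. If \<open>p2\<close> were 0, the
  first relation would force \<open>p1 = 1\<close>.\<close>

lemma quadratic_cycle:
  fixes u v :: real
  assumes "u \<noteq> v" "p1 < 1" "v = k - p1 * u - p2 * u\<^sup>2" "u = k - p1 * v - p2 * v\<^sup>2"
  shows "p2 \<noteq> 0" "u + v = cycle_sum p1 p2" "(v - u)\<^sup>2 = cycle_discr k p1 p2"
proof -
  have "(v - u) * (p1 + p2 * (u + v)) = (k - p1 * u - p2 * u\<^sup>2) - (k - p1 * v - p2 * v\<^sup>2)"
    by (simp add: algebra_simps power2_eq_square)
  also have "\<dots> = v - u"
    by (simp only: assms(3,4)[symmetric])
  finally have "(v - u) * (p1 + p2 * (u + v)) = v - u" .
  with \<open>u \<noteq> v\<close> have 1: "p1 + p2 * (u + v) = 1"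
    by simp
  with \<open>p1 < 1\<close> show p2: "p2 \<noteq> 0"
    by auto
  with 1 show s: "u + v = cycle_sum p1 p2"
    by (simp add: cycle_sum_def field_simps)
  have "u + v = (k - p1 * u - p2 * u\<^sup>2) + (k - p1 * v - p2 * v\<^sup>2)"
    using assms(3,4) by linarith
  then have "(u + v) * (1 + p1) = 2 * k - p2 * (u\<^sup>2 + v\<^sup>2)"
    by (simp add: algebra_simps)
  also have "u\<^sup>2 + v\<^sup>2 = ((u + v)\<^sup>2 + (v - u)\<^sup>2) / 2"
    by (simp add: power2_eq_square algebra_simps)
  finally show "(v - u)\<^sup>2 = cycle_discr k p1 p2"
    unfolding cycle_discr_def s[symmetric] using p2 by (simp add: field_simps)
qed

text \<open>The computation is reversed: the prescribed sum and difference restore the difference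
  and the sum of the two equations.\<close>

lemma quadratic_cycle_exists:
  fixes u v :: real
  assumes "p2 \<noteq> 0" "0 \<le> cycle_discr k p1 p2"
    and u: "u = (cycle_sum p1 p2 - sqrt (cycle_discr k p1 p2)) / 2"
    and v: "v = (cycle_sum p1 p2 + sqrt (cycle_discr k p1 p2)) / 2"
  shows "v = k - p1 * u - p2 * u\<^sup>2" "u = k - p1 * v - p2 * v\<^sup>2"
proof -
  have s: "u + v = cycle_sum p1 p2" and "v - u = sqrt (cycle_discr k p1 p2)"
    by (simp_all add: u v field_simps)
  then have d: "(v - u)\<^sup>2 = 2 / p2 * (2 * k - (u + v) * (1 + p1)) - (u + v)\<^sup>2"
    using assms(2) by (simp add: cycle_discr_def)
  have 1: "p1 + p2 * (u + v) = 1"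
    using assms(1) by (simp add: s cycle_sum_def)
  have "p2 * ((v - u)\<^sup>2 + (u + v)\<^sup>2) = 2 * (2 * k - (u + v) * (1 + p1))"
    using assms(1) d by simp
  then have "(u + v) * (1 + p1) = 2 * k - p2 * (u\<^sup>2 + v\<^sup>2)"
    by (simp add: power2_eq_square algebra_simps)
  then have sum: "u + v = (k - p1 * u - p2 * u\<^sup>2) + (k - p1 * v - p2 * v\<^sup>2)"
    by (simp add: algebra_simps)
  have "(v - u) * (p1 + p2 * (u + v)) = v - u"
    by (simp add: 1)
  then have "v - u = (k - p1 * u - p2 * u\<^sup>2) - (k - p1 * v - p2 * v\<^sup>2)"
    by (simp add: power2_eq_square algebra_simps)
  with sum show "v = k - p1 * u - p2 * u\<^sup>2" "u = k - p1 * v - p2 * v\<^sup>2"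
    by linarith+
qed

section \<open>The 2-cycle formed by the win values for distributions on {0, 1, 2}\<close>

definition binary_pmfs :: "nat pmf set" where
  "binary_pmfs = {p. set_pmf p \<subseteq> {0, 1, 2} \<and> 0 < pmf p 0 \<and> pmf p 0 < 1}"

text \<open>This is the constant term of \<open>1 - (pgf p x - of_bool a * pmf p 0)\<close>: it is
  \<open>1 - pmf p 0\<close> in normal play and 1 in misere play.\<close>

definition cycle_const :: "bool \<Rightarrow> nat pmf \<Rightarrow> real" where
  "cycle_const a p = 1 - of_bool (\<not> a) * pmf p 0"

lemma binary_iteration:
  assumes "p \<in> binary_pmfs" "0 \<le> x" "x \<le> 1"
  shows "1 - (pgf p x - of_bool a * pmf p 0) = cycle_const a p - pmf p 1 * x - pmf p 2 * x\<^sup>2"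
  using assms by (simp add: pgf_binary binary_pmfs_def cycle_const_def)

text \<open>Complementing Previous' value makes the two equations a single map applied back and
  forth. The difference of \<open>v a p\<close> and \<open>u a p\<close> is the draw probability, so
  a possible draw makes the 2-cycle genuine.\<close>

lemma win_value_iteration:
  defines "u \<equiv> \<lambda>a p. win_value a (\<not> a) p True" and "v \<equiv> \<lambda>a p. 1 - win_value a (\<not> a) p False"
  assumes "p \<in> binary_pmfs"
  shows "v a p = cycle_const a p - pmf p 1 * u a p - pmf p 2 * (u a p)\<^sup>2"
    "u a p = cycle_const a p - pmf p 1 * v a p - pmf p 2 * (v a p)\<^sup>2"
proof -
  have "v a p = 1 - (pgf p (u a p) - of_bool a * pmf p 0)"
    unfolding u_def v_def using win_value_False[of a "\<not> a" p] by simp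
  then show "v a p = cycle_const a p - pmf p 1 * u a p - pmf p 2 * (u a p)\<^sup>2"
    using assms win_value_bounds by (simp add: binary_iteration)
  have "u a p = 1 - (pgf p (v a p) - of_bool a * pmf p 0)"
    unfolding u_def v_def by (rule win_value_True)
  then show "u a p = cycle_const a p - pmf p 1 * v a p - pmf p 2 * (v a p)\<^sup>2"
    using assms win_value_bounds by (simp add: binary_iteration)
qed

lemma binary_pmfs_sum:
  assumes "p \<in> binary_pmfs"
  shows "pmf p 0 + pmf p 1 + pmf p 2 = 1"
  using pgf_binary[of p 1] assms by (simp add: binary_pmfs_def)

lemma draw_value_pos_cycle:
  assumes p: "p \<in> binary_pmfs" and D: "0 < draw_value a p"
  defines "u \<equiv> win_value a (\<not> a) p True" and "v \<equiv> 1 - win_value a (\<not> a) p False"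
  shows "0 < pmf p 2" "0 < u" "v < 1"
    "u + v = cycle_sum (pmf p 1) (pmf p 2)"
    "(v - u)\<^sup>2 = cycle_discr (cycle_const a p) (pmf p 1) (pmf p 2)"
proof -
  have p0: "0 < pmf p 0" "pmf p 0 < 1"
    using p by (auto simp: binary_pmfs_def)
  have p1: "pmf p 1 < 1"
    using binary_pmfs_sum[OF p] p0 pmf_nonneg[of p 2] by linarith
  have uv: "u < v"
    using D by (simp add: u_def v_def draw_value_def)
  have bounds: "0 \<le> u" "u \<le> 1" "0 \<le> v" "v \<le> 1"
    by (auto simp: u_def v_def win_value_bounds)
  have v_eq: "v = cycle_const a p - pmf p 1 * u - pmf p 2 * u\<^sup>2"
    and u_eq: "u = cycle_const a p - pmf p 1 * v - pmf p 2 * v\<^sup>2"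
    unfolding u_def v_def by (rule win_value_iteration[OF p])+
  note cyc = quadratic_cycle[OF _ p1 v_eq u_eq]
  show p2: "0 < pmf p 2"
    using cyc(1) uv pmf_nonneg[of p 2] by linarith
  show "u + v = cycle_sum (pmf p 1) (pmf p 2)"
    "(v - u)\<^sup>2 = cycle_discr (cycle_const a p) (pmf p 1) (pmf p 2)"
    using cyc uv by auto
  \<comment> \<open>One bound follows at once from \<open>0 < pmf p 0\<close>: \<open>0 < u\<close>
    in misere play, where the constant is 1, and \<open>v < 1\<close> in normal play, where it is
    \<open>1 - pmf p 0\<close>. The other one follows by applying the map once more.\<close>
  have "0 < u \<and> v < 1"
  proof (cases a)
    case True
    have "pmf p 1 * v + pmf p 2 * v\<^sup>2 \<le> pmf p 1 * 1 + pmf p 2 * 1"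
      using bounds by (intro add_mono mult_left_mono power_le_one) auto
    then have "0 < u"
      using u_eq True p0 binary_pmfs_sum[OF p] by (simp add: cycle_const_def)
    moreover from this have "0 < pmf p 1 * u + pmf p 2 * u\<^sup>2"
      using p2 by (intro add_nonneg_pos) auto
    ultimately show ?thesis
      using v_eq True by (simp add: cycle_const_def)
  next
    case False
    have "0 \<le> pmf p 1 * u + pmf p 2 * u\<^sup>2"
      using bounds by simp
    then have v: "v < 1"
      using v_eq False p0 by (simp add: cycle_const_def)
    then have "pmf p 1 * v + pmf p 2 * v\<^sup>2 < pmf p 1 * 1 + pmf p 2 * 1"
      using bounds p2
      by (intro add_le_less_mono mult_left_mono mult_strict_left_mono) (auto simp: power_less_one_iff)
    then show ?thesis
      using v u_eq False binary_pmfs_sum[OF p] by (simp add: cycle_const_def)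
  qed
  then show "0 < u" "v < 1"
    by auto
qed

text \<open>The win values bound every 2-cycle in the unit interval, so near a distribution with a
  positive draw probability the perturbed cycle bounds that probability from below.\<close>

lemma draw_value_ge:
  assumes q: "q \<in> binary_pmfs" "0 < pmf q 2"
    and \<Delta>: "\<Delta> = cycle_discr (cycle_const a q) (pmf q 1) (pmf q 2)" "0 < \<Delta>"
    and lower: "0 < (cycle_sum (pmf q 1) (pmf q 2) - sqrt \<Delta>) / 2"
    and upper: "(cycle_sum (pmf q 1) (pmf q 2) + sqrt \<Delta>) / 2 < 1"
  shows "sqrt \<Delta> \<le> draw_value a q"
proof -
  define u v where "u = (cycle_sum (pmf q 1) (pmf q 2) - sqrt \<Delta>) / 2"
    and "v = (cycle_sum (pmf q 1) (pmf q 2) + sqrt \<Delta>) / 2"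
  have uv: "v - u = sqrt \<Delta>"
    by (simp add: u_def v_def field_simps)
  then have "u < v"
    using \<Delta>(2) by (metis diff_gt_0_iff_gt real_sqrt_gt_zero)
  moreover have "0 < u" "v < 1"
    using lower upper by (simp_all only: u_def v_def)
  ultimately have bounds: "0 \<le> u" "u \<le> 1" "0 \<le> v" "v \<le> 1"
    by linarith+
  have "pmf q 2 \<noteq> 0" "0 \<le> cycle_discr (cycle_const a q) (pmf q 1) (pmf q 2)"
    using q(2) \<Delta> by auto
  note cyc = quadratic_cycle_exists[OF this u_def[unfolded \<Delta>(1)] v_def[unfolded \<Delta>(1)]]
  have "1 - (pgf q v - of_bool a * pmf q 0) \<le> u"
    using binary_iteration[OF q(1) bounds(3,4), of a] cyc(2) by linarith
  moreover have "pgf q u - of_bool (\<not> \<not> a) * pmf q 0 \<le> 1 - v"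
    unfolding not_not using binary_iteration[OF q(1) bounds(1,2), of a] cyc(1) by linarith
  ultimately have "win_value a (\<not> a) q True \<le> u" "win_value a (\<not> a) q False \<le> 1 - v"
    using win_value_least[OF bounds] by blast+
  then show ?thesis
    using uv by (simp add: draw_value_def)
qed

text \<open>Upper semicontinuity bounds nearby draw probabilities from above. From below,
  nonnegativity suffices where the draw probability is 0, and elsewhere the cycle persists.\<close>

lemma continuous_map_draw_value_binary:
  "continuous_map (subtopology M0_topology binary_pmfs) euclideanreal (draw_value a)"
  unfolding continuous_map_atin limitin_canonical_iff
proof
  fix p assume "p \<in> topspace (subtopology M0_topology binary_pmfs)"
  then have p: "p \<in> binary_pmfs" by simp
  let ?F = "atin (subtopology M0_topology binary_pmfs) p"
  have open_ev: "\<forall>\<^sub>F q in ?F. q \<in> U" if "openin M0_topology U" "p \<in> U" for U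
    using that p by (auto simp: atin_subtopology_within eventually_atin_within)
  have ev_binary: "\<forall>\<^sub>F q in ?F. q \<in> binary_pmfs"
    using p by (auto simp: atin_subtopology_within eventually_within_imp)
  have pmf: "((\<lambda>q. pmf q k) \<longlongrightarrow> pmf p k) ?F" for k
    using continuous_map_from_subtopology[OF continuous_map_pmf, of binary_pmfs k] p
    by (simp add: continuous_map_atin)
  show "(draw_value a \<longlongrightarrow> draw_value a p) ?F"
  proof (rule order_tendstoI)
    fix y assume "draw_value a p < y"
    moreover have "openin M0_topology {q. draw_value a q < y}"
      using upper_semicontinuous_map_draw_value[of a] by (simp add: upper_semicontinuous_map_def)
    ultimately show "\<forall>\<^sub>F q in ?F. draw_value a q < y"
      using open_ev[of "{q. draw_value a q < y}"] by simp
  next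
    fix y assume y: "y < draw_value a p"
    show "\<forall>\<^sub>F q in ?F. y < draw_value a q"
    proof (cases "draw_value a p = 0")
      case True
      with y have "y < draw_value a q" for q
        using draw_value_nonneg[of a q] by linarith
      then show ?thesis by simp
    next
      case False
      then have pos: "0 < draw_value a p"
        using draw_value_nonneg[of a p] by simp
      define s where "s q = cycle_sum (pmf q 1) (pmf q 2)" for q :: "nat pmf"
      define \<Delta> where "\<Delta> q = cycle_discr (cycle_const a q) (pmf q 1) (pmf q 2)" for q
      define u v where "u = win_value a (\<not> a) p True" and "v = 1 - win_value a (\<not> a) p False"
      note cyc = draw_value_pos_cycle[OF p pos, folded u_def v_def]
      have "v - u = draw_value a p"
        by (simp add: u_def v_def draw_value_def)
      then have D: "sqrt (\<Delta> p) = draw_value a p"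
        using cyc(5) pos by (metis \<Delta>_def less_imp_le real_sqrt_unique)
      have s_lim: "(s \<longlongrightarrow> s p) ?F"
        unfolding s_def cycle_sum_def using cyc(1) by (intro tendsto_divide tendsto_diff tendsto_const pmf) simp
      have "((\<lambda>q. cycle_const a q) \<longlongrightarrow> cycle_const a p) ?F"
        unfolding cycle_const_def by (intro tendsto_diff tendsto_mult tendsto_const pmf)
      then have \<Delta>_lim: "(\<Delta> \<longlongrightarrow> \<Delta> p) ?F"
        using s_lim cyc(1) unfolding \<Delta>_def cycle_discr_def s_def[symmetric]
        by (intro tendsto_divide tendsto_diff tendsto_add tendsto_mult tendsto_power tendsto_const pmf) auto
      have sqrt_lim: "((\<lambda>q. sqrt (\<Delta> q)) \<longlongrightarrow> draw_value a p) ?F"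
        unfolding D[symmetric] by (rule tendsto_real_sqrt[OF \<Delta>_lim])
      have "0 < \<Delta> p"
        using D pos by (metis real_sqrt_gt_0_iff)
      have "(s p - draw_value a p) / 2 = u" "(s p + draw_value a p) / 2 = v"
        using cyc(4) \<open>v - u = draw_value a p\<close> by (auto simp: s_def)
      then have lim: "((\<lambda>q. (s q - sqrt (\<Delta> q)) / 2) \<longlongrightarrow> u) ?F"
          "((\<lambda>q. (s q + sqrt (\<Delta> q)) / 2) \<longlongrightarrow> v) ?F"
        using tendsto_divide[OF tendsto_diff[OF s_lim sqrt_lim] tendsto_const[of 2]]
          tendsto_divide[OF tendsto_add[OF s_lim sqrt_lim] tendsto_const[of 2]] by auto
      \<comment> \<open>All hypotheses of \<open>draw_value_ge\<close> other than membership in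
        \<open>binary_pmfs\<close> are strict inequalities between quantities convergent at
        \<open>p\<close>, and they hold in the limit.\<close>
      have "\<forall>\<^sub>F q in ?F. sqrt (\<Delta> q) \<le> draw_value a q"
        using ev_binary order_tendstoD(1)[OF pmf cyc(1)] order_tendstoD(1)[OF \<Delta>_lim \<open>0 < \<Delta> p\<close>]
          order_tendstoD(1)[OF lim(1) cyc(2)] order_tendstoD(2)[OF lim(2) cyc(3)]
      proof eventually_elim
        case (elim q)
        then show ?case
          using draw_value_ge[of q "\<Delta> q" a] by (simp add: s_def \<Delta>_def)
      qed
      with order_tendstoD(1)[OF sqrt_lim y] show ?thesis
        by eventually_elim simp
    qed
  qed
qed

subsection \<open>The escape game\<close>

lemma offspring_mean_eq:
  assumes "p \<in> M1"
  shows "offspring_mean p = (\<Sum>\<^sub>\<infinity>k. real k * pmf p k)"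
proof -
  have "Infinite_Set_Sum.abs_summable_on (\<lambda>k. real k * pmf p k) UNIV"
    using assms by (simp add: summable_on_M1 abs_summable_equivalent[symmetric] abs_mult)
  from infsetsum_infsum[OF this] show ?thesis
    by (simp add: offspring_mean_def pmf_expectation_eq_infsetsum mult.commute)
qed

lemma offspring_mean_sums: "p \<in> M1 \<Longrightarrow> (\<lambda>k. real k * pmf p k) sums offspring_mean p"
  by (simp add: offspring_mean_eq has_sum_imp_sums has_sum_infsum summable_on_M1)

lemma offspring_mean_nonneg: "p \<in> M1 \<Longrightarrow> 0 \<le> offspring_mean p"
  by (simp add: offspring_mean_eq infsum_nonneg)

lemma offspring_mean_le_add_d1:
  assumes "p \<in> M1" "q \<in> M1"
  shows "offspring_mean p \<le> offspring_mean q + d1 p q"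
proof -
  have "offspring_mean p \<le> (\<Sum>\<^sub>\<infinity>k. real k * pmf q k + real k * \<bar>pmf p k - pmf q k\<bar>)"
    unfolding offspring_mean_eq[OF assms(1)]
  proof (rule infsum_mono)
    show "(\<lambda>k. real k * pmf q k + real k * \<bar>pmf p k - pmf q k\<bar>) summable_on UNIV"
      using assms by (intro summable_on_add summable_on_diff_M1) (simp_all add: summable_on_M1)
    show "real k * pmf p k \<le> real k * pmf q k + real k * \<bar>pmf p k - pmf q k\<bar>" for k
      unfolding distrib_left[symmetric] by (rule mult_left_mono) auto
  qed (use assms(1) in \<open>simp add: summable_on_M1\<close>)
  also have "\<dots> = offspring_mean q + d1 p q"
    unfolding offspring_mean_eq[OF assms(2)] d1_def
    using assms by (intro infsum_add summable_on_diff_M1) (simp_all add: summable_on_M1)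
  finally show ?thesis .
qed

lemma has_sum_indicator_0: "((\<lambda>k. if k = 0 then x else 0) has_sum (x::real)) (UNIV :: nat set)"
  by (rule has_sum_finite_neutralI[of "{0}"]) auto

text \<open>\<open>d1\<close> ignores the weight at 0, which is however determined by the other weights.\<close>

lemma pmf_0_le_add_d1:
  assumes "p \<in> M1" "q \<in> M1"
  shows "pmf q 0 \<le> pmf p 0 + d1 p q"
proof -
  have "1 \<le> 1 + d1 p q + (pmf p 0 - pmf q 0)"
  proof (rule has_sum_mono)
    show "(pmf p has_sum 1) UNIV"
      using has_sum_infsum[OF summable_on_pgf[of 1 p]] pgf_1[of p] by (simp add: pgf_def)
    have "(pmf q has_sum 1) UNIV"
      using has_sum_infsum[OF summable_on_pgf[of 1 q]] pgf_1[of q] by (simp add: pgf_def)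
    then show "((\<lambda>k. pmf q k + real k * \<bar>pmf p k - pmf q k\<bar>
        + (if k = 0 then pmf p 0 - pmf q 0 else 0)) has_sum (1 + d1 p q + (pmf p 0 - pmf q 0))) UNIV"
      unfolding d1_def
      by (intro has_sum_add has_sum_indicator_0 has_sum_infsum summable_on_diff_M1 assms)
    show "pmf p k \<le> pmf q k + real k * \<bar>pmf p k - pmf q k\<bar>
        + (if k = 0 then pmf p 0 - pmf q 0 else 0)" for k
      using mult_right_mono[of 1 "real k" "\<bar>pmf p k - pmf q k\<bar>"] by (cases "k = 0") auto
  qed
  then show ?thesis by simp
qed

text \<open>Terms with positive index are dominated since \<open>real k\<close> is at least 1, and
  the term at 0 costs another \<open>d1 p q\<close>. Thus openness for \<open>d0\<close> carries
  over to \<open>d1\<close>.\<close>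

lemma d0_le_d1:
  assumes "p \<in> M1" "q \<in> M1"
  shows "d0 p q \<le> 2 * d1 p q"
proof -
  have "d0 p q \<le> d1 p q + \<bar>pmf p 0 - pmf q 0\<bar>"
  proof (rule has_sum_mono)
    show "((\<lambda>k. \<bar>pmf p k - pmf q k\<bar>) has_sum d0 p q) UNIV"
      unfolding d0_def by (intro has_sum_infsum summable_on_diff_pmf)
    show "((\<lambda>k. real k * \<bar>pmf p k - pmf q k\<bar> + (if k = 0 then \<bar>pmf p 0 - pmf q 0\<bar> else 0))
        has_sum (d1 p q + \<bar>pmf p 0 - pmf q 0\<bar>)) UNIV"
      unfolding d1_def
      by (intro has_sum_add has_sum_indicator_0 has_sum_infsum summable_on_diff_M1 assms)
    show "\<bar>pmf p k - pmf q k\<bar>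
        \<le> real k * \<bar>pmf p k - pmf q k\<bar> + (if k = 0 then \<bar>pmf p 0 - pmf q 0\<bar> else 0)" for k
      using mult_right_mono[of 1 "real k" "\<bar>pmf p k - pmf q k\<bar>"] by (cases "k = 0") auto
  qed
  moreover have "\<bar>pmf p 0 - pmf q 0\<bar> \<le> d1 p q"
    using pmf_0_le_add_d1[OF assms] pmf_0_le_add_d1[OF assms(2,1)] M1.commute[of p q] by simp
  ultimately show ?thesis by simp
qed

section \<open>Bounds for the generating function near 0 and 1\<close>

lemma one_minus_pgf_sums:
  assumes "0 \<le> z" "z \<le> 1"
  shows "(\<lambda>k. pmf p k * (1 - z ^ k)) sums (1 - pgf p z)"
  using sums_diff[OF pgf_sums[of 1 p] pgf_sums[OF assms]] by (simp add: algebra_simps)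

text \<open>The factor \<open>1 - z\<close> splits off from \<open>1 - z ^ k\<close> and leaves
  \<open>k\<close> powers of \<open>z\<close>, each at most 1.\<close>

lemma one_minus_pgf_le:
  assumes "p \<in> M1" "0 \<le> z" "z \<le> 1"
  shows "1 - pgf p z \<le> offspring_mean p * (1 - z)"
proof (rule sums_le[OF _ one_minus_pgf_sums sums_mult2[OF offspring_mean_sums]])
  fix k
  have "(\<Sum>i<k. z ^ i) \<le> (\<Sum>i<k. 1)"
    using assms by (intro sum_mono power_le_one) auto
  then have "1 - z ^ k \<le> (1 - z) * real k"
    unfolding one_diff_power_eq using assms by (intro mult_left_mono) auto
  then have "pmf p k * (1 - z ^ k) \<le> pmf p k * ((1 - z) * real k)"
    by (rule mult_left_mono) simp
  then show "pmf p k * (1 - z ^ k) \<le> real k * pmf p k * (1 - z)"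
    by (simp add: mult_ac)
qed (use assms in auto)

lemma pgf_ge_linear:
  assumes "0 \<le> x" "x \<le> 1"
  shows "pmf p 0 + pmf p 1 * x \<le> pgf p x"
proof -
  have "(\<Sum>k\<in>{0, 1}. pmf p k * x ^ k) \<le> (\<Sum>k. pmf p k * x ^ k)"
    by (rule sum_le_suminf) (use pgf_sums[OF assms, of p] assms in \<open>auto simp: summable_def\<close>)
  then show ?thesis
    using pgf_sums[OF assms, of p] by (simp add: sums_iff)
qed

text \<open>All terms of degree at least 2 together are at most \<open>x\<^sup>2\<close>, as the
  total mass is 1. This coefficient is uniform in \<open>p\<close> and asks for no second
  moment.\<close>

lemma pgf_le_quadratic:
  assumes "0 \<le> x" "x \<le> 1"
  shows "pgf p x \<le> pmf p 0 + pmf p 1 * x + x\<^sup>2"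
proof -
  let ?f = "\<lambda>k::nat. (if k = 0 then pmf p 0 else if k = 1 then pmf p 1 * x else 0)"
  have "pgf p x \<le> (\<Sum>k\<in>{0, 1}. ?f k) + 1 * x\<^sup>2"
  proof (rule sums_le)
    show "(\<lambda>k. pmf p k * x ^ k) sums pgf p x"
      by (rule pgf_sums[OF assms])
    have "?f sums (\<Sum>k\<in>{0, 1}. ?f k)"
      by (rule sums_finite) auto
    moreover have "pmf p sums 1"
      using pgf_sums[of 1 p] by simp
    ultimately show "(\<lambda>k. ?f k + pmf p k * x\<^sup>2) sums ((\<Sum>k\<in>{0, 1}. ?f k) + 1 * x\<^sup>2)"
      by (intro sums_add sums_mult2)
    show "pmf p k * x ^ k \<le> ?f k + pmf p k * x\<^sup>2" for k
    proof (cases "k < 2")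
      case True
      then have "k = 0 \<or> k = 1" by auto
      then show ?thesis by auto
    next
      case False
      then have "x ^ k \<le> x\<^sup>2"
        using assms by (intro power_decreasing) auto
      then show ?thesis
        using False by (auto intro!: mult_left_mono)
    qed
  qed
  then show ?thesis by simp
qed

section \<open>Positivity of Escaper's win probability\<close>

lemma escaper_E1_eq: "escaper_E1 p = 1 - pgf p (1 - escaper_E2 p)"
  using win_value_False[of True True p]
  by (simp add: escaper_E1_def escaper_E2_def outcome_eq_win_value)

lemma escaper_E2_eq: "escaper_E2 p = pgf p (escaper_E1 p) - pmf p 0"
  using win_value_True[of True True p]
  by (simp add: escaper_E1_def escaper_E2_def outcome_eq_win_value)

lemma escaper_bounds:
  "0 \<le> escaper_E1 p" "escaper_E1 p \<le> 1" "0 \<le> escaper_E2 p" "escaper_E2 p \<le> 1"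
  by (simp_all add: escaper_E1_def escaper_E2_def outcome_eq_win_value win_value_bounds)

lemma escaper_E1_pos_iff: "0 < escaper_E1 p \<longleftrightarrow> 0 < escaper_E2 p"
proof -
  have "escaper_E1 p = 0 \<longleftrightarrow> escaper_E2 p = 0"
    using escaper_E1_eq[of p] escaper_E2_eq[of p] by auto
  then show ?thesis
    using escaper_bounds[of p] by linarith
qed

lemma escaper_E1_le:
  assumes "p \<in> M1"
  shows "escaper_E1 p \<le> offspring_mean p * (pmf p 1 + escaper_E1 p) * escaper_E1 p"
proof -
  let ?e = "escaper_E1 p"
  have "?e \<le> offspring_mean p * escaper_E2 p"
    using one_minus_pgf_le[OF assms, of "1 - escaper_E2 p"] escaper_bounds[of p]
    by (simp flip: escaper_E1_eq)
  also have "escaper_E2 p \<le> (pmf p 1 + ?e) * ?e"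
    using pgf_le_quadratic[of ?e p] escaper_bounds[of p]
    by (simp add: escaper_E2_eq algebra_simps power2_eq_square)
  finally show ?thesis
    using offspring_mean_nonneg[OF assms] by (simp add: mult_left_mono mult.assoc)
qed

text \<open>Dividing \<open>escaper_E1_le\<close> by a positive value would contradict the
  hypothesis. So a positive value cannot be arbitrarily small where the mean times
  \<open>pmf p 1\<close> stays below 1.\<close>

lemma escaper_E1_eq_0:
  assumes "p \<in> M1" "offspring_mean p * (pmf p 1 + escaper_E1 p) < 1"
  shows "escaper_E1 p = 0"
proof (rule ccontr)
  assume "escaper_E1 p \<noteq> 0"
  then have "0 < escaper_E1 p"
    using escaper_bounds[of p] by simp
  with assms(2) have "offspring_mean p * (pmf p 1 + escaper_E1 p) * escaper_E1 p < escaper_E1 p"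
    by simp
  with escaper_E1_le[OF assms(1)] show False by simp
qed

text \<open>By \<open>win_value_least\<close> it is enough to find \<open>x > 0\<close> below
  \<open>escaper_E1 p\<close> and \<open>y\<close> below \<open>escaper_E2 p\<close> that support
  each other. Taking \<open>y = pmf p 1 * x\<close>, the linear lower bound on \<open>pgf\<close>
  gives one inequality. The other, \<open>x \<le> 1 - pgf p (1 - y)\<close>, holds for small
  \<open>y\<close>, the mean being above \<open>1 / pmf p 1\<close>.\<close>

lemma escaper_E1_pos:
  assumes p: "p \<in> M1" and gt: "1 < offspring_mean p * pmf p 1"
  shows "0 < escaper_E1 p"
proof -
  have p1: "0 < pmf p 1"
    using gt pmf_nonneg[of p 1] by (metis less_le mult_zero_right not_one_less_zero)
  have "1 / pmf p 1 < offspring_mean p"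
    using gt p1 by (simp add: field_simps)
  moreover have "(\<lambda>n. \<Sum>k<n. real k * pmf p k) \<longlonglongrightarrow> offspring_mean p"
    using offspring_mean_sums[OF p] by (simp add: sums_def)
  ultimately have "\<forall>\<^sub>F n in sequentially. 1 / pmf p 1 < (\<Sum>k<n. real k * pmf p k)"
    by (simp add: order_tendstoD(1))
  then obtain n where n: "1 / pmf p 1 < (\<Sum>k<n. real k * pmf p k)"
    using eventually_happens'[OF sequentially_bot] by blast
  \<comment> \<open>\<open>h y\<close> is a partial sum of \<open>(1 - pgf p (1 - y)) / y\<close>.
    The truncation at \<open>n\<close> makes it a polynomial, continuous at 0, where its value is
    the truncated mean.\<close>
  define h where "h y = (\<Sum>k<n. pmf p k * (\<Sum>i<k. (1 - y) ^ i))" for y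
  have "isCont h 0"
    unfolding h_def by (intro continuous_intros)
  then have "(h \<longlongrightarrow> h 0) (at_right 0)"
    by (simp add: isCont_def filterlim_at_split)
  moreover have "1 / pmf p 1 < h 0"
    using n by (simp add: h_def mult.commute)
  ultimately have "\<forall>\<^sub>F y in at_right 0. 1 / pmf p 1 < h y"
    by (rule order_tendstoD(1))
  \<comment> \<open>The upper limit for \<open>y\<close> keeps \<open>x = y / pmf p 1\<close> at
    most 1.\<close>
  moreover have "\<forall>\<^sub>F y in at_right (0::real). y \<in> {0<..<pmf p 1}"
    using p1 by (rule eventually_at_right_real)
  ultimately have "\<forall>\<^sub>F y in at_right 0. 1 / pmf p 1 < h y \<and> y \<in> {0<..<pmf p 1}"
    by (rule eventually_conj)
  then obtain y where y: "1 / pmf p 1 < h y" "0 < y" "y < pmf p 1"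
    using eventually_happens'[OF trivial_limit_at_right_real] by force
  define x where "x = y / pmf p 1"
  have x: "0 < x" "x \<le> 1" "pmf p 1 * x = y"
    using y p1 by (auto simp: x_def)
  have y1: "0 \<le> 1 - y" "1 - y \<le> 1"
    using y pmf_le_1[of p 1] by auto
  have "y * h y = (\<Sum>k<n. pmf p k * (1 - (1 - y) ^ k))"
    unfolding h_def one_diff_power_eq by (simp add: sum_distrib_left mult_ac)
  also have "\<dots> \<le> (\<Sum>k. pmf p k * (1 - (1 - y) ^ k))"
    by (rule sum_le_suminf)
       (use one_minus_pgf_sums[OF y1, of p] y1 in \<open>auto simp: summable_def power_le_one\<close>)
  also have "\<dots> = 1 - pgf p (1 - y)"
    using one_minus_pgf_sums[OF y1, of p] by (simp add: sums_iff)
  finally have "y * h y \<le> 1 - pgf p (1 - y)" .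
  moreover have "x \<le> y * h y"
    using mult_strict_left_mono[OF y(1,2)] by (simp add: x_def)
  ultimately have "pgf p (1 - y) - of_bool (\<not> True) * pmf p 0 \<le> 1 - x"
    by simp
  moreover have "1 - (pgf p x - of_bool True * pmf p 0) \<le> 1 - y"
    using pgf_ge_linear[of x p] x by simp
  ultimately have "win_value True True p False \<le> 1 - x"
    using y1 x by (intro win_value_least(2)[of "1 - y"]) auto
  then show ?thesis
    using x by (simp add: escaper_E1_def outcome_eq_win_value)
qed

text \<open>\<open>escaper_E1\<close> is only upper semicontinuous, but the condition bounds a
  product that increases in each nonnegative ingredient, so upper bounds for nearby distributions
  suffice.\<close>

lemma openin_escaper_below:
  "openin M1_topology {p \<in> M1. offspring_mean p * (pmf p 1 + escaper_E1 p) < 1}"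
  (is "openin _ ?U")
  unfolding M1_topology_def M1.openin_mtopology
proof (intro conjI allI impI)
  fix p assume "p \<in> ?U"
  then have p: "p \<in> M1" and lt: "offspring_mean p * (pmf p 1 + escaper_E1 p) < 1"
    by auto
  \<comment> \<open>Each ingredient gets a margin. It is doubled for \<open>pmf p 1\<close>, which
    is controlled by \<open>d0\<close>, hence by twice \<open>d1\<close>; the same factor explains
    the radius \<open>r / 2\<close> below.\<close>
  have "((\<lambda>\<delta>. (offspring_mean p + \<delta>) * ((pmf p 1 + 2 * \<delta>) + (escaper_E1 p + \<delta>))) \<longlongrightarrow>
      (offspring_mean p + 0) * ((pmf p 1 + 2 * 0) + (escaper_E1 p + 0))) (at_right 0)"
    by (intro tendsto_mult tendsto_add tendsto_const tendsto_ident_at)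
  then have "\<forall>\<^sub>F \<delta> in at_right 0.
      (offspring_mean p + \<delta>) * ((pmf p 1 + 2 * \<delta>) + (escaper_E1 p + \<delta>)) < 1"
    by (rule order_tendstoD(2)) (use lt in simp)
  moreover have "\<forall>\<^sub>F \<delta> in at_right (0::real). 0 < \<delta>"
    by (rule eventually_at_right_less)
  ultimately have "\<forall>\<^sub>F \<delta> in at_right 0.
      (offspring_mean p + \<delta>) * ((pmf p 1 + 2 * \<delta>) + (escaper_E1 p + \<delta>)) < 1 \<and> 0 < \<delta>"
    by (rule eventually_conj)
  then obtain \<delta> where \<delta>: "0 < \<delta>"
    "(offspring_mean p + \<delta>) * ((pmf p 1 + 2 * \<delta>) + (escaper_E1 p + \<delta>)) < 1"
    using eventually_happens'[OF trivial_limit_at_right_real] by force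
  have "upper_semicontinuous_map M0_topology escaper_E1"
    unfolding escaper_E1_def[abs_def] outcome_eq_win_value
    by (intro upper_semicontinuous_map_one_minus lower_semicontinuous_map_win_value)
  then have "openin M0_topology {q. escaper_E1 q < escaper_E1 p + \<delta>}"
    by (simp add: upper_semicontinuous_map_def)
  then have "p \<in> {q. escaper_E1 q < escaper_E1 p + \<delta>} \<Longrightarrow>
      \<exists>r>0. M0.mball p r \<subseteq> {q. escaper_E1 q < escaper_E1 p + \<delta>}"
    unfolding M0_topology_def M0.openin_mtopology by blast
  then obtain r where r: "0 < r" "M0.mball p r \<subseteq> {q. escaper_E1 q < escaper_E1 p + \<delta>}"
    using \<delta>(1) by auto
  show "\<exists>r>0. M1.mball p r \<subseteq> ?U"
  proof (intro exI conjI subsetI)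
    show "0 < min \<delta> (r / 2)"
      using \<delta> r by simp
    fix q assume "q \<in> M1.mball p (min \<delta> (r / 2))"
    then have q: "q \<in> M1" "d1 p q < \<delta>" "2 * d1 p q < r"
      by auto
    have d0: "d0 p q \<le> 2 * d1 p q"
      by (rule d0_le_d1[OF p q(1)])
    have "q \<in> M0.mball p r"
      using d0 q by simp
    then have "escaper_E1 q \<le> escaper_E1 p + \<delta>"
      using r(2) by (auto dest!: subsetD)
    moreover have "pmf q 1 \<le> pmf p 1 + 2 * \<delta>"
      using abs_pmf_diff_le_d0[of p 1 q] d0 q by linarith
    moreover have "offspring_mean q \<le> offspring_mean p + \<delta>"
      using offspring_mean_le_add_d1[OF q(1) p] M1.commute[of p q] q by simp
    ultimately have "offspring_mean q * (pmf q 1 + escaper_E1 q)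
        \<le> (offspring_mean p + \<delta>) * ((pmf p 1 + 2 * \<delta>) + (escaper_E1 p + \<delta>))"
      using offspring_mean_nonneg[OF p] escaper_bounds(1)[of q] \<delta>(1)
      by (intro mult_mono add_mono add_nonneg_nonneg) auto
    with \<delta>(2) q(1) show "q \<in> ?U" by simp
  qed
qed auto

text \<open>Inside \<open>B\<close>, the value is 0 iff the open condition of
  \<open>openin_escaper_below\<close> holds: one direction is the definition of \<open>B\<close>,
  the other is \<open>escaper_E1_eq_0\<close>.\<close>

lemma closedin_escaper_E1_pos:
  fixes B :: "nat pmf set"
  defines "B \<equiv> {p \<in> M1. offspring_mean p * pmf p 1 < 1}"
  shows "closedin (subtopology M1_topology B) ({p. 0 < escaper_E1 p} \<inter> B)"
proof -
  have "B - {p. 0 < escaper_E1 p} \<inter> B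
      = {p \<in> M1. offspring_mean p * (pmf p 1 + escaper_E1 p) < 1} \<inter> B"
  proof (intro equalityI subsetI)
    fix p assume "p \<in> B - {p. 0 < escaper_E1 p} \<inter> B"
    moreover from this have "escaper_E1 p = 0"
      using escaper_bounds(1)[of p] by auto
    ultimately show "p \<in> {p \<in> M1. offspring_mean p * (pmf p 1 + escaper_E1 p) < 1} \<inter> B"
      by (auto simp: B_def)
  next
    fix p assume "p \<in> {p \<in> M1. offspring_mean p * (pmf p 1 + escaper_E1 p) < 1} \<inter> B"
    then show "p \<in> B - {p. 0 < escaper_E1 p} \<inter> B"
      using escaper_E1_eq_0[of p] by auto
  qed
  moreover have "topspace (subtopology M1_topology B) = B"
    by (auto simp: B_def)
  ultimately show ?thesis
    unfolding closedin_def openin_subtopology using openin_escaper_below by auto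
qed

theorem theorem5:
  shows
    "(lower_semicontinuous_map M0_topology normal_N \<and>
      lower_semicontinuous_map M0_topology normal_P \<and>
      lower_semicontinuous_map M0_topology misere_N \<and>
      lower_semicontinuous_map M0_topology misere_P \<and>
      lower_semicontinuous_map M0_topology stopper_S1 \<and>
      lower_semicontinuous_map M0_topology stopper_S2 \<and>
      upper_semicontinuous_map M0_topology normal_D \<and>
      continuous_map (subtopology M0_topology {p. normal_D p = 0}) euclideanreal normal_N \<and>
      continuous_map (subtopology M0_topology {p. normal_D p = 0}) euclideanreal normal_P \<and>
      upper_semicontinuous_map M0_topology misere_D \<and>
      continuous_map (subtopology M0_topology {p. misere_D p = 0}) euclideanreal misere_N \<and>
      continuous_map (subtopology M0_topology {p. misere_D p = 0}) euclideanreal misere_P)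
     \<and>
     (let A = {p. set_pmf p \<subseteq> {0, 1, 2} \<and> 0 < pmf p 0 \<and> pmf p 0 < 1} in
      continuous_map (subtopology M0_topology A) euclideanreal normal_D \<and>
      continuous_map (subtopology M0_topology A) euclideanreal misere_D)
     \<and>
     ({p \<in> M1. offspring_mean p * pmf p 1 > 1} \<subseteq> {p. escaper_E1 p > 0} \<and>
      (let B = {p \<in> M1. offspring_mean p * pmf p 1 < 1} in
       closedin (subtopology M1_topology B) ({p. escaper_E1 p > 0} \<inter> B)) \<and>
      (\<forall>p. escaper_E1 p > 0 \<longleftrightarrow> escaper_E2 p > 0))"
proof (unfold Let_def, intro conjI)
  note lsc = lower_semicontinuous_map_win_value
  show "lower_semicontinuous_map M0_topology normal_N" "lower_semicontinuous_map M0_topology normal_P"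
    "lower_semicontinuous_map M0_topology misere_N" "lower_semicontinuous_map M0_topology misere_P"
    "lower_semicontinuous_map M0_topology stopper_S1" "lower_semicontinuous_map M0_topology stopper_S2"
    by (simp_all add: outcome_eq_win_value[abs_def] lsc)
  show "upper_semicontinuous_map M0_topology normal_D" "upper_semicontinuous_map M0_topology misere_D"
    by (simp_all add: draw_eq upper_semicontinuous_map_draw_value)
  show "continuous_map (subtopology M0_topology {p. normal_D p = 0}) euclideanreal normal_N"
    "continuous_map (subtopology M0_topology {p. normal_D p = 0}) euclideanreal normal_P"
    using continuous_map_win_value_no_draw[of False]
    by (simp_all add: draw_eq outcome_eq_win_value[abs_def])
  show "continuous_map (subtopology M0_topology {p. misere_D p = 0}) euclideanreal misere_N"
    "continuous_map (subtopology M0_topology {p. misere_D p = 0}) euclideanreal misere_P"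
    using continuous_map_win_value_no_draw[of True]
    by (simp_all add: draw_eq outcome_eq_win_value[abs_def])
  show "continuous_map (subtopology M0_topology
      {p. set_pmf p \<subseteq> {0, 1, 2} \<and> 0 < pmf p 0 \<and> pmf p 0 < 1}) euclideanreal normal_D"
    "continuous_map (subtopology M0_topology
      {p. set_pmf p \<subseteq> {0, 1, 2} \<and> 0 < pmf p 0 \<and> pmf p 0 < 1}) euclideanreal misere_D"
    unfolding draw_eq binary_pmfs_def[symmetric] by (rule continuous_map_draw_value_binary)+
  show "{p \<in> M1. offspring_mean p * pmf p 1 > 1} \<subseteq> {p. escaper_E1 p > 0}"
    using escaper_E1_pos by auto
  show "closedin (subtopology M1_topology {p \<in> M1. offspring_mean p * pmf p 1 < 1})
      ({p. escaper_E1 p > 0} \<inter> {p \<in> M1. offspring_mean p * pmf p 1 < 1})"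
    by (rule closedin_escaper_E1_pos)
  show "\<forall>p. escaper_E1 p > 0 \<longleftrightarrow> escaper_E2 p > 0"
    using escaper_E1_pos_iff by blast
qed

end
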